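(* Let $(\mathcal A,E)$ be a non-commutative probability space and let $\{X_i\}_{i=1}^{\infty}$ be a sequence of free unitary operators in $\mathcal A$ with spectral probability measures $\mu_i$. For $n\ge 1$ let $\mu^{(n)}$ be the spectral probability measure of the product $\Pi_n=X_1X_2\cdots X_n$. Then the measures $\mu^{(n)}$ converge weakly, as $n\to\infty$, to the uniform probability measure on the unit circle if and only if at least one of the following holds: (i) there exist two indices $i\neq j$ such that $EX_i=EX_j=0$; (ii) there exists exactly one index $i$ such that $EX_i=0$, and for this $i$, $\prod_{k=i+1}^{n}EX_k\to 0$ as $n\to\infty$; (iii) there exists exactly one index $i$ such that $X_i$ has the uniform distribution (i.e. $\mu_i$ is the uniform probability measure on the unit circle); (iv) $EX_k\neq 0$ for all $k$, and $\prod_{k=1}^{n}EX_k\to 0$ as $n\to\infty$.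
   Context: A non-commutative probability space is a pair $(\mathcal A,E)$, where $\mathcal A$ is a unital $C^*$-algebra of bounded linear operators on a complex separable Hilbert space and $E:\mathcal A\to\mathbb C$ is a linear functional (the expectation) such that $E(I)=1$; $E(A^* )=\overline{E(A)}$; $E(AA^* )\ge 0$; $E(AA^* )=0$ implies $A=0$; and $E$ is norm continuous. The spectral probability measure of a unitary $X\in\mathcal A$ is the probability measure $\mu$ on the unit circle with $E(f(X))=\int_{|\xi|=1} f(\xi)\,d\mu(\xi)$ for all continuous $f$ on the circle (i.e. $\mu(d\lambda)=E(P(d\lambda))$ with $P$ the spectral resolution of $X$). In particular $EX=\int\xi\,d\mu(\xi)$. For $A\in\mathcal A$, the algebra generated by $A$ is the norm closure of all polynomials in $A$ and $A^*$ (including constants). Variables $A_1,\dots,A_n$ are free if, with $\mathcal A_i$ the algebra generated by $A_i$, one has $E(\overline A_{1}\cdots\overline A_{m})=0$ whenever $m\ge 1$, $\overline A_{s}\in\mathcal A_{i(s)}$, $E(\overline A_{s})=0$ for all $s$, and $i(s+1)\ne i(s)$ for all $s<m$. An infinite sequence is free if every finite subfamily is free. *)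

theory Defs
  imports "HOL-Probability.Probability"
begin

text \<open>Complex Hilbert spaces. The inner product is linear in its first argument. The real
  inner product space structure of the superclass is the underlying real one, so norm and topology
  are those induced by the complex inner product; positive definiteness is inherited.\<close>

class complex_hilbert_space = real_inner + complete_space +
  fixes scaleC :: "complex \<Rightarrow> 'a \<Rightarrow> 'a"  (infixr \<open>*\<^sub>C\<close> 75)
    and cinner :: "'a \<Rightarrow> 'a \<Rightarrow> complex"
  assumes scaleC_add_right: "c *\<^sub>C (x + y) = c *\<^sub>C x + c *\<^sub>C y"
    and scaleC_add_left: "(c + d) *\<^sub>C x = c *\<^sub>C x + d *\<^sub>C x"
    and scaleC_scaleC: "c *\<^sub>C d *\<^sub>C x = (c * d) *\<^sub>C x"
    and scaleC_of_real: "complex_of_real r *\<^sub>C x = r *\<^sub>R x"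
    and cinner_commute: "cinner y x = cnj (cinner x y)"
    and cinner_add_left: "cinner (x + y) z = cinner x z + cinner y z"
    and cinner_scaleC_left: "cinner (c *\<^sub>C x) y = c * cinner x y"
    and inner_eq_Re_cinner: "inner x y = Re (cinner x y)"

lemma norm_scaleC: "norm (c *\<^sub>C x) = cmod c * norm (x :: 'a :: complex_hilbert_space)"
proof -
  have r: "cinner u (c *\<^sub>C v) = cnj c * cinner u v" for u v :: 'a
    by (metis cinner_commute cinner_scaleC_left complex_cnj_mult)
  have "inner (c *\<^sub>C x) (c *\<^sub>C x) = Re ((c * cnj c) * cinner x x)"
    by (simp add: inner_eq_Re_cinner cinner_scaleC_left r mult.assoc mult.left_commute)
  also have "\<dots> = (cmod c)\<^sup>2 * inner x x"
    by (simp add: complex_norm_square[symmetric] inner_eq_Re_cinner del: of_real_power)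
  finally show ?thesis
    by (simp add: norm_eq_sqrt_inner real_sqrt_mult)
qed

lemma bounded_linear_scaleC: "bounded_linear (\<lambda>x :: 'a :: complex_hilbert_space. c *\<^sub>C x)"
proof (rule bounded_linear_intro)
  show "c *\<^sub>C (r *\<^sub>R x) = r *\<^sub>R (c *\<^sub>C x)" for r and x :: 'a
    by (metis scaleC_of_real scaleC_scaleC mult.commute)
  show "norm (c *\<^sub>C x) \<le> norm x * cmod c" for x :: 'a
    by (simp add: norm_scaleC mult.commute)
qed (rule scaleC_add_right)


text \<open>Bounded operators are elements of \<^typ>\<open>'h \<Rightarrow>\<^sub>L 'h\<close>, whose norm is the operator norm. That type
  only imposes linearity over the reals.\<close>

type_synonym 'h oper = "'h \<Rightarrow>\<^sub>L 'h"

definition clinear_oper :: "'h::complex_hilbert_space oper \<Rightarrow> bool" where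
  "clinear_oper T \<longleftrightarrow> (\<forall>c x. blinfun_apply T (c *\<^sub>C x) = c *\<^sub>C blinfun_apply T x)"

lift_definition oscale :: "complex \<Rightarrow> 'h::complex_hilbert_space oper \<Rightarrow> 'h oper" is
  "\<lambda>c T x. c *\<^sub>C T x"
  by (rule bounded_linear_compose[OF bounded_linear_scaleC])

text \<open>On complex linear operators the adjoint exists and is unique by the Riesz representation
  theorem.\<close>

definition adj :: "'h::complex_hilbert_space oper \<Rightarrow> 'h oper" where
  "adj T = (THE S. \<forall>x y. cinner (blinfun_apply T x) y = cinner x (blinfun_apply S y))"

definition unitary_oper :: "'h::complex_hilbert_space oper \<Rightarrow> bool" where
  "unitary_oper U \<longleftrightarrow> clinear_oper U \<and> U o\<^sub>L adj U = id_blinfun \<and> adj U o\<^sub>L U = id_blinfun"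

definition oprod :: "'h::complex_hilbert_space oper list \<Rightarrow> 'h oper" where
  "oprod Ts = foldr (o\<^sub>L) Ts id_blinfun"

locale cstar_operator_algebra =
  fixes \<A> :: "'h::complex_hilbert_space oper set"
  assumes clinear: "A \<in> \<A> \<Longrightarrow> clinear_oper A"
    and id_mem: "id_blinfun \<in> \<A>"
    and add_mem: "A \<in> \<A> \<Longrightarrow> B \<in> \<A> \<Longrightarrow> A + B \<in> \<A>"
    and oscale_mem: "A \<in> \<A> \<Longrightarrow> oscale c A \<in> \<A>"
    and comp_mem: "A \<in> \<A> \<Longrightarrow> B \<in> \<A> \<Longrightarrow> A o\<^sub>L B \<in> \<A>"
    and adj_mem: "A \<in> \<A> \<Longrightarrow> adj A \<in> \<A>"
    and norm_closed: "closed \<A>"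

text \<open>For a metrizable topology, second countability is separability. The expectation is a total
  function of which only the values on the algebra are constrained.\<close>

locale nc_prob_space = cstar_operator_algebra \<A>
  for \<A> :: "'h::{complex_hilbert_space, second_countable_topology} oper set" +
  fixes E :: "'h oper \<Rightarrow> complex"
  assumes E_add: "A \<in> \<A> \<Longrightarrow> B \<in> \<A> \<Longrightarrow> E (A + B) = E A + E B"
    and E_oscale: "A \<in> \<A> \<Longrightarrow> E (oscale c A) = c * E A"
    and E_id: "E id_blinfun = 1"
    and E_adj: "A \<in> \<A> \<Longrightarrow> E (adj A) = cnj (E A)"
    and E_nonneg: "A \<in> \<A> \<Longrightarrow> E (A o\<^sub>L adj A) \<in> \<real>\<^sub>\<ge>\<^sub>0"
    and E_faithful: "A \<in> \<A> \<Longrightarrow> E (A o\<^sub>L adj A) = 0 \<Longrightarrow> A = 0"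
    and E_continuous: "continuous_on \<A> E"


inductive_set star_polynomials :: "'h::complex_hilbert_space oper \<Rightarrow> 'h oper set"
  for A :: "'h oper" where
  "id_blinfun \<in> star_polynomials A"
| "A \<in> star_polynomials A"
| "adj A \<in> star_polynomials A"
| "S \<in> star_polynomials A \<Longrightarrow> T \<in> star_polynomials A \<Longrightarrow> S + T \<in> star_polynomials A"
| "S \<in> star_polynomials A \<Longrightarrow> oscale c S \<in> star_polynomials A"
| "S \<in> star_polynomials A \<Longrightarrow> T \<in> star_polynomials A \<Longrightarrow> S o\<^sub>L T \<in> star_polynomials A"

definition generated_algebra :: "'h::complex_hilbert_space oper \<Rightarrow> 'h oper set" where
  "generated_algebra A = closure (star_polynomials A)"

definition free_family ::
    "('h::complex_hilbert_space oper \<Rightarrow> complex) \<Rightarrow> 'i set \<Rightarrow> ('i \<Rightarrow> 'h oper) \<Rightarrow> bool" where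
  "free_family E I X \<longleftrightarrow>
    (\<forall>m i B. 1 \<le> m \<longrightarrow>
       (\<forall>s\<in>{1..m}. i s \<in> I \<and> B s \<in> generated_algebra (X (i s)) \<and> E (B s) = 0) \<longrightarrow>
       (\<forall>s\<in>{1..<m}. i (s + 1) \<noteq> i s) \<longrightarrow>
       E (oprod (map B [1..<m + 1])) = 0)"

definition free_sequence ::
    "('h::complex_hilbert_space oper \<Rightarrow> complex) \<Rightarrow> (nat \<Rightarrow> 'h oper) \<Rightarrow> bool" where
  "free_sequence E X \<longleftrightarrow> (\<forall>F. finite F \<longrightarrow> F \<subseteq> {1..} \<longrightarrow> free_family E F X)"


abbreviation unit_circle :: "complex set" where
  "unit_circle \<equiv> sphere 0 1"

definition laurent :: "nat \<Rightarrow> (int \<Rightarrow> complex) \<Rightarrow> complex \<Rightarrow> complex" where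
  "laurent N a z = (\<Sum>k = - int N..int N. a k * z powi k)"

definition unitary_powi :: "'h::complex_hilbert_space oper \<Rightarrow> int \<Rightarrow> 'h oper" where
  "unitary_powi U k =
    (if 0 \<le> k then oprod (replicate (nat k) U) else oprod (replicate (nat (- k)) (adj U)))"

definition laurent_oper ::
    "nat \<Rightarrow> (int \<Rightarrow> complex) \<Rightarrow> 'h::complex_hilbert_space oper \<Rightarrow> 'h oper" where
  "laurent_oper N a U = (\<Sum>k = - int N..int N. oscale (a k) (unitary_powi U k))"

text \<open>Continuous functional calculus of a unitary: the operator \<open>f(U)\<close> is the norm limit of
  \<open>p\<^sub>n(U)\<close> for any Laurent polynomials \<open>p\<^sub>n\<close> converging to \<open>f\<close> uniformly on the unit circle. Such
  \<open>p\<^sub>n\<close> exist by Weierstrass, and the limit exists and does not depend on their choice because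
  \<open>\<parallel>p(U)\<parallel> \<le> sup {\<bar>p(\<xi>)\<bar>. \<bar>\<xi>\<bar> = 1}\<close>.\<close>

definition functional_calculus ::
    "'h::complex_hilbert_space oper \<Rightarrow> (complex \<Rightarrow> complex) \<Rightarrow> 'h oper" where
  "functional_calculus U f =
    (THE T. \<forall>N a. uniform_limit unit_circle (\<lambda>n. laurent (N n) (a n)) f sequentially \<longrightarrow>
                  (\<lambda>n. laurent_oper (N n) (a n) U) \<longlonglongrightarrow> T)"

definition circle_prob_measure :: "complex measure \<Rightarrow> bool" where
  "circle_prob_measure M \<longleftrightarrow> prob_space M \<and> sets M = sets (restrict_space borel unit_circle)"

definition spectral_prob_measure ::
    "('h::complex_hilbert_space oper \<Rightarrow> complex) \<Rightarrow> 'h oper \<Rightarrow> complex measure \<Rightarrow> bool" where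
  "spectral_prob_measure E U M \<longleftrightarrow> circle_prob_measure M \<and>
    (\<forall>f. continuous_on unit_circle f \<longrightarrow> E (functional_calculus U f) = (\<integral>\<xi>. f \<xi> \<partial>M))"

definition uniform_circle :: "complex measure" where
  "uniform_circle =
    distr (uniform_measure lborel {0..<2 * pi}) (restrict_space borel unit_circle) cis"

text \<open>No boundedness of \<open>f\<close> is required: continuous functions on the circle are bounded.\<close>

definition circle_weak_conv :: "(nat \<Rightarrow> complex measure) \<Rightarrow> complex measure \<Rightarrow> bool" where
  "circle_weak_conv M L \<longleftrightarrow>
    (\<forall>f :: complex \<Rightarrow> real. continuous_on unit_circle f \<longrightarrow>
       (\<lambda>n. \<integral>\<xi>. f \<xi> \<partial>(M n)) \<longlonglongrightarrow> (\<integral>\<xi>. f \<xi> \<partial>L))"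

lemma circle_prob_measure_uniform_circle: "circle_prob_measure uniform_circle"
proof -
  interpret prob_space "uniform_measure lborel {0..<2 * pi}"
    by (rule prob_space_uniform_measure) auto
  have "cis \<in> measurable (uniform_measure lborel {0..<2 * pi}) (restrict_space borel unit_circle)"
  proof (rule measurable_restrict_space2)
    have "cis \<in> borel_measurable borel"
      by (intro borel_measurable_continuous_onI continuous_intros)
    then show "cis \<in> borel_measurable (uniform_measure lborel {0..<2 * pi})"
      by (simp add: measurable_def uniform_measure_def)
  qed auto
  then show ?thesis
    unfolding circle_prob_measure_def uniform_circle_def by (simp add: prob_space_distr)
qed

end

theory Submission
  imports Defs
begin

text \<open>Convergence to the uniform measure means that every moment \<open>E(\<Pi>\<^sub>n\<^sup>k)\<close> with \<open>k \<ge> 1\<close> tends to \<open>0\<close>;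
  freeness gives \<open>E \<Pi>\<^sub>n = \<Prod> E X\<^sub>k\<close>. The \<open>S\<close>-transform is not needed: if \<open>A\<close> and \<open>B\<close> are free with means
  \<open>a\<close> and \<open>b\<close>, then \<open>E(((A - a)(B - b))\<^sup>k) = 0\<close>, so \<open>E((A B)\<^sup>k) = O(\<bar>a\<bar> + \<bar>b\<bar>)\<close>. In cases (i), (ii) and (iv)
  one may cut \<open>\<Pi>\<^sub>n\<close> at a fixed place \<open>m\<close> so that both pieces have small mean for all large \<open>n\<close>. For the
  remaining case, if \<open>k\<close> is the order of the first nonzero moment of \<open>X\<^sub>i\<close> and \<open>A\<close>, \<open>X\<^sub>i\<close>, \<open>B\<close> are free, then
  \<open>E((A X\<^sub>i B)\<^sup>k) = (E A E B)\<^sup>k E(X\<^sub>i\<^sup>k)\<close>, and all powers have mean \<open>0\<close> if \<open>X\<^sub>i\<close> is uniformly distributed.\<close>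

subsection \<open>Adjoints and unitary operators\<close>

text \<open>Two definite descriptions shape the operator side: \<open>adj\<close> and
  \<open>functional_calculus\<close> cannot be evaluated before existence and uniqueness are shown.
  Riesz settles the first. For the second, only moments are extracted from spectral measures, so
  f(U) is computed for Laurent polynomials only; the bound of the norm of p(U) by the supremum of
  |p| on the circle comes from finite Fourier sums.

  On the free side, spans of alternating centred words are tracked by their end indices alone: words
  can be concatenated once the letters that meet differ, and all have expectation 0. With A' = A - a
  and B' = B - b, every power of A' B' is such a span, while A B - A' B' = b A + a B' is small. In
  (A X B)^k the inner factors B A have mean a b; as the lower powers of X are centred, replacing B A
  by its mean costs only words that begin and end with X.

  The cut gives upper bounds for moments, which is sufficiency. Necessity needs an exact moment: at
  the first nonzero moment of X, convergence to 0 forces the product of the other means to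
  0.\<close>

lemma riesz_representation_real:
  fixes f :: "'a::{real_inner,complete_space} \<Rightarrow> real"
  assumes "bounded_linear f"
  obtains y where "\<And>x. f x = inner x y"
proof -
  interpret f: bounded_linear f by fact
  \<comment> \<open>If \<open>y\<close> represents \<open>f\<close>, then \<open>J x\<close> equals
    \<open>(norm (x - y))\<^sup>2 - (norm y)\<^sup>2\<close>, so the representing vector is sought
    as the minimiser of \<open>J\<close>.\<close>
  define J where "J x = (norm x)\<^sup>2 - 2 * f x" for x
  obtain K where K: "\<And>x. norm (f x) \<le> norm x * K" using f.bounded by auto
  have lower: "J x \<ge> - K\<^sup>2" for x
  proof -
    have "2 * f x \<le> 2 * (norm x * K)" using K[of x] by auto
    moreover have "0 \<le> (norm x - K)\<^sup>2" by simp
    ultimately show ?thesis by (simp add: J_def power2_diff)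
  qed
  define m where "m = (INF x. J x)"
  have bdd: "bdd_below (range J)" using lower by (auto intro!: bdd_belowI)
  have m: "m \<le> J x" for x unfolding m_def by (rule cINF_lower[OF bdd]) simp
  have "\<exists>x. J x < m + 1 / real (Suc n)" for n
    using cINF_less_iff[of UNIV J, OF _ bdd, of "m + 1 / real (Suc n)"]
    by (auto simp: m_def)
  then obtain u where u: "\<And>n. J (u n) < m + 1 / real (Suc n)" by metis
  \<comment> \<open>The parallelogram law, with \<open>J\<close> at the midpoint bounded below by
    \<open>m\<close>, makes a minimising sequence Cauchy.\<close>
  have par: "(norm (x - y))\<^sup>2 \<le> 2 * (J x - m) + 2 * (J y - m)" for x y
  proof -
    have half: "norm ((1/2) *\<^sub>R (x + y)) = norm (x + y) / 2" by simp
    have "4 * J ((1/2) *\<^sub>R (x + y)) = (norm (x + y))\<^sup>2 - 4 * (f x + f y)"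
      unfolding J_def half f.scaleR f.add by (simp add: power_divide field_simps)
    moreover have "(norm (x - y))\<^sup>2 + (norm (x + y))\<^sup>2 = 2 * (norm x)\<^sup>2 + 2 * (norm y)\<^sup>2"
      by (simp add: power2_norm_eq_inner inner_add inner_diff inner_commute)
    ultimately show ?thesis using m[of "(1/2) *\<^sub>R (x + y)"]
      by (simp add: J_def algebra_simps)
  qed
  have "Cauchy u"
  proof (rule metric_CauchyI)
    fix e :: real assume e: "e > 0"
    obtain N where N: "4 / e\<^sup>2 < real N" using reals_Archimedean2 by blast
    have "dist (u k) (u l) < e" if "k \<ge> N" "l \<ge> N" for k l
    proof -
      have N0: "0 < real N" using N e by (smt (verit) zero_le_divide_iff zero_le_power2)
      have *: "1 / real (Suc i) \<le> 1 / real N" if "i \<ge> N" for i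
        using that N0 by (intro divide_left_mono) auto
      have "(norm (u k - u l))\<^sup>2 < 4 / real N"
        using par[of "u k" "u l"] u[of k] u[of l] *[OF that(1)] *[OF that(2)]
        by (simp add: divide_inverse)
      also have "4 / real N < e\<^sup>2" using N N0 e by (simp add: field_simps)
      finally show ?thesis using e by (simp add: dist_norm power2_less_imp_less)
    qed
    then show "\<exists>M. \<forall>m\<ge>M. \<forall>n\<ge>M. dist (u m) (u n) < e" by blast
  qed
  then obtain y where y: "u \<longlonglongrightarrow> y" using Cauchy_convergent convergent_def by blast
  have "(\<lambda>n. J (u n)) \<longlonglongrightarrow> J y"
    unfolding J_def by (intro tendsto_intros f.tendsto y)
  moreover have "(\<lambda>n. m + 1 / real (Suc n)) \<longlonglongrightarrow> m + 0"
    by (intro tendsto_intros) (use LIMSEQ_inverse_real_of_nat in \<open>simp add: divide_inverse\<close>)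
  ultimately have Jy: "J y \<le> m"
    using u by (intro LIMSEQ_le[of "\<lambda>n. J (u n)" _ "\<lambda>n. m + 1 / real (Suc n)"]) (auto intro: less_imp_le)
  have "f x = inner x y" for x
  proof -
    define d where "d = inner x y - f x"
    have quad: "0 \<le> 2 * t * d + t\<^sup>2 * (norm x)\<^sup>2" for t
    proof -
      have "(norm (y + t *\<^sub>R x))\<^sup>2 = (norm y)\<^sup>2 + 2 * t * inner x y + t\<^sup>2 * (norm x)\<^sup>2"
        unfolding power2_norm_eq_inner
        by (simp add: inner_add inner_commute power2_eq_square algebra_simps)
      then have "J (y + t *\<^sub>R x) = J y + 2 * t * d + t\<^sup>2 * (norm x)\<^sup>2"
        by (simp add: J_def d_def f.add f.scaleR algebra_simps)
      then show ?thesis using m[of "y + t *\<^sub>R x"] Jy by linarith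
    qed
    \<comment> \<open>The choice \<open>t = - d / s\<close> nearly minimises the quadratic in
      \<open>t\<close>; the added 1 keeps \<open>s\<close> positive when
      \<open>x = 0\<close>.\<close>
    define s where "s = (norm x)\<^sup>2 + 1"
    have s: "s > 0" "(norm x)\<^sup>2 \<le> s" by (auto simp: s_def add_pos_nonneg add_nonneg_pos)
    have "0 \<le> 2 * (- d / s) * d + (- d / s)\<^sup>2 * (norm x)\<^sup>2" by (rule quad)
    also have "\<dots> \<le> 2 * (- d / s) * d + (- d / s)\<^sup>2 * s"
      using s by (intro add_left_mono mult_left_mono) auto
    also have "\<dots> = - (d\<^sup>2 / s)" using s by (simp add: field_simps power2_eq_square)
    finally have "d\<^sup>2 / s \<le> 0" by simp
    then have "d = 0" using s by (simp add: divide_le_0_iff)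
    then show ?thesis by (simp add: d_def)
  qed
  then show ?thesis by (rule that)
qed

lemma cinner_scaleC_right: "cinner x (c *\<^sub>C y) = cnj c * cinner x (y :: 'a::complex_hilbert_space)"
  by (metis cinner_commute cinner_scaleC_left complex_cnj_mult)

lemma cinner_add_right: "cinner x (y + z) = cinner x y + cinner x (z :: 'a::complex_hilbert_space)"
  by (metis cinner_add_left cinner_commute complex_cnj_add)

lemma Im_cinner: "Im (cinner x y) = inner (- \<i> *\<^sub>C x) (y :: 'a::complex_hilbert_space)"
  by (simp add: inner_eq_Re_cinner cinner_scaleC_left)

text \<open>Two solutions of the adjoint equation have the same inner product with every vector, so
  a single witness evaluates the definite description.\<close>

lemma adj_eqI:
  fixes T S :: "'h::complex_hilbert_space oper"
  assumes "\<And>x y. cinner (T x) y = cinner x (S y)"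
  shows "adj T = S"
  unfolding adj_def
proof (rule the_equality)
  fix R :: "'h oper" assume R: "\<forall>x y. cinner (T x) y = cinner x (R y)"
  show "R = S"
  proof (rule blinfun_eqI)
    fix y
    have "inner x (R y) = inner x (S y)" for x
      using R assms by (simp add: inner_eq_Re_cinner)
    from this[of "R y - S y"] have "inner (R y - S y) (R y - S y) = 0" by (simp add: inner_diff_right)
    then show "R y = S y" by simp
  qed
qed (use assms in simp)

text \<open>Riesz, applied to \<open>inner (T x) y\<close> as a functional of \<open>x\<close>,
  yields the adjoint one vector \<open>y\<close> at a time; Cauchy-Schwarz bounds the resulting
  map.\<close>

lemma cinner_adj:
  fixes T :: "'h::complex_hilbert_space oper"
  assumes "clinear_oper T"
  shows "cinner (T x) y = cinner x (adj T y)"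
proof -
  have "\<exists>z. \<forall>x. inner (T x) y = inner x z" for y
    by (rule riesz_representation_real[of "\<lambda>x. inner (T x) y"])
       (auto intro: bounded_linear_compose[OF bounded_linear_inner_left] blinfun.bounded_linear_right)
  then obtain g where g: "\<And>x y. inner (T x) y = inner x (g y)" by metis
  have eqI: "u = v" if "\<And>x. inner x u = inner x v" for u v :: 'h
    using that[of "u - v"] by (metis eq_iff_diff_eq_0 inner_diff_right inner_eq_zero_iff)
  have "bounded_linear g"
  proof (rule bounded_linear_intro)
    show "g (y + z) = g y + g z" for y z
      by (rule eqI) (simp add: inner_add_right g[symmetric])
    show "g (r *\<^sub>R y) = r *\<^sub>R g y" for r y
      by (rule eqI) (simp add: g[symmetric])
    show "norm (g y) \<le> norm y * norm T" for y
    proof (cases "g y = 0")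
      case False
      have "norm (g y) * norm (g y) = inner (T (g y)) y"
        by (simp add: g power2_norm_eq_inner[symmetric] power2_eq_square)
      also have "\<dots> \<le> norm (T (g y)) * norm y" by (rule norm_cauchy_schwarz)
      also have "\<dots> \<le> norm T * norm (g y) * norm y"
        by (intro mult_right_mono norm_blinfun) simp
      finally show ?thesis using False by (simp add: mult.commute mult.left_commute)
    qed simp
  qed
  then obtain S :: "'h oper" where S: "\<And>y. S y = g y"
    using bounded_linear_Blinfun_apply by metis
  have SP: "\<forall>x y. cinner (T x) y = cinner x (S y)"
  proof (intro allI complex_eqI)
    show "Re (cinner (T x) y) = Re (cinner x (S y))" for x y
      by (simp add: inner_eq_Re_cinner[symmetric] S g)
    \<comment> \<open>The imaginary part is the real part at \<open>- \<i> *\<^sub>C x\<close>, and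
      complex linearity lets \<open>T\<close> pass through this scalar.\<close>
    show "Im (cinner (T x) y) = Im (cinner x (S y))" for x y
      using assms by (metis Im_cinner clinear_oper_def S g)
  qed
  have "adj T = S" by (rule adj_eqI) (simp add: SP)
  then show ?thesis using SP by simp
qed

lemma norm_unitary_oper:
  assumes "unitary_oper U"
  shows "norm (blinfun_apply U x) = norm x"
proof -
  have "adj U (U x) = x"
    using assms by (metis unitary_oper_def blinfun_apply_blinfun_compose blinfun_apply_id_blinfun)
  moreover have "cinner (U x) (U x) = cinner x (adj U (U x))"
    using assms by (intro cinner_adj) (simp add: unitary_oper_def)
  ultimately show ?thesis by (simp add: norm_eq_sqrt_inner inner_eq_Re_cinner)
qed

lemma oprod_simps [simp]: "oprod [] = id_blinfun" "oprod (T # Ts) = T o\<^sub>L oprod Ts"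
  by (simp_all add: oprod_def)

lemma blinfun_compose_id [simp]: "id_blinfun o\<^sub>L T = T" "T o\<^sub>L id_blinfun = T"
  by (auto intro!: blinfun_eqI)

lemma blinfun_compose_assoc: "(S o\<^sub>L T) o\<^sub>L U = S o\<^sub>L (T o\<^sub>L U)"
  by (auto intro!: blinfun_eqI)

lemma oprod_append: "oprod (Ss @ Ts) = oprod Ss o\<^sub>L oprod Ts"
  by (induction Ss) (auto simp: blinfun_compose_assoc)

lemma oprod_replicate_apply: "blinfun_apply (oprod (replicate k T)) x = (blinfun_apply T ^^ k) x"
  by (induction k) auto

section \<open>Sesquilinear algebra and products of unitaries\<close>

lemma scaleC_0 [simp]: "0 *\<^sub>C x = (0 :: 'a::complex_hilbert_space)"
  by (metis of_real_0 scaleC_of_real scaleR_zero_left)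

lemma scaleC_zero_right [simp]: "c *\<^sub>C (0 :: 'a::complex_hilbert_space) = 0"
  by (rule linear_0[OF bounded_linear.linear[OF bounded_linear_scaleC]])

lemma scaleC_1 [simp]: "1 *\<^sub>C x = (x :: 'a::complex_hilbert_space)"
  by (metis of_real_1 scaleC_of_real scaleR_one)

lemma scaleC_diff_right: "c *\<^sub>C (x - y) = c *\<^sub>C x - c *\<^sub>C (y :: 'a::complex_hilbert_space)"
  by (metis add_diff_cancel_right' diff_add_cancel scaleC_add_right)

lemma scaleC_diff_left: "(c - d) *\<^sub>C x = c *\<^sub>C x - d *\<^sub>C (x :: 'a::complex_hilbert_space)"
  by (metis add_diff_cancel_right' diff_add_cancel scaleC_add_left)

lemma scaleC_minus_left: "(- c) *\<^sub>C x = - (c *\<^sub>C (x :: 'a::complex_hilbert_space))"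
  using scaleC_diff_left[of 0 c x] by simp

lemma scaleC_sum_right: "c *\<^sub>C sum f A = (\<Sum>i\<in>A. c *\<^sub>C (f i :: 'a::complex_hilbert_space))"
  by (rule linear_sum[OF bounded_linear.linear[OF bounded_linear_scaleC]])

lemma cinner_zero [simp]: "cinner 0 x = 0" "cinner (x :: 'a::complex_hilbert_space) 0 = 0"
  using cinner_scaleC_left[of 0 x x] cinner_scaleC_right[of x 0 x] by simp_all

lemma cinner_sum_left: "cinner (sum f A) x = (\<Sum>i\<in>A. cinner (f i :: 'a::complex_hilbert_space) x)"
  by (induction A rule: infinite_finite_induct) (auto simp: cinner_add_left)

lemma cinner_sum_right: "cinner x (sum f A) = (\<Sum>i\<in>A. cinner x (f i :: 'a::complex_hilbert_space))"
  by (induction A rule: infinite_finite_induct) (auto simp: cinner_add_right)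

lemma cinner_self: "cinner x x = complex_of_real ((norm (x :: 'a::complex_hilbert_space))\<^sup>2)"
proof (rule complex_eqI)
  show "Re (cinner x x) = Re (complex_of_real ((norm x)\<^sup>2))"
    by (simp add: inner_eq_Re_cinner[symmetric] power2_norm_eq_inner)
  have "Im (cinner x x) = - Im (cinner x x)" by (metis cinner_commute cnj.simps(2))
  then show "Im (cinner x x) = Im (complex_of_real ((norm x)\<^sup>2))" by simp
qed

lemma unitary_oper_id: "unitary_oper id_blinfun"
proof -
  have "adj id_blinfun = (id_blinfun :: 'a oper)" by (rule adj_eqI) simp
  then show ?thesis by (simp add: unitary_oper_def clinear_oper_def)
qed

lemma unitary_oper_compose:
  assumes S: "unitary_oper S" and T: "unitary_oper T"
  shows "unitary_oper (S o\<^sub>L T)"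
proof -
  have lin: "clinear_oper S" "clinear_oper T" using S T by (auto simp: unitary_oper_def)
  have "adj (S o\<^sub>L T) = adj T o\<^sub>L adj S"
    by (rule adj_eqI) (simp add: cinner_adj lin)
  moreover have "S o\<^sub>L T o\<^sub>L (adj T o\<^sub>L adj S) = S o\<^sub>L (T o\<^sub>L adj T) o\<^sub>L adj S"
    "adj T o\<^sub>L adj S o\<^sub>L (S o\<^sub>L T) = adj T o\<^sub>L (adj S o\<^sub>L S) o\<^sub>L T"
    by (simp_all only: blinfun_compose_assoc)
  ultimately show ?thesis
    using S T by (simp add: unitary_oper_def clinear_oper_def)
qed

lemma unitary_oper_oprod: "(\<And>T. T \<in> set Ts \<Longrightarrow> unitary_oper T) \<Longrightarrow> unitary_oper (oprod Ts)"
  by (induction Ts) (auto intro: unitary_oper_id unitary_oper_compose)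

lemma norm_unitary_oper_le: "unitary_oper U \<Longrightarrow> norm U \<le> 1"
  by (rule norm_blinfun_bound) (simp_all add: norm_unitary_oper)

subsection \<open>Functional calculus of a unitary\<close>

text \<open>Orthogonality of the characters of the cyclic group of order \<open>M\<close>. Off the
  diagonal this is a geometric sum with ratio \<open>z\<close>, where \<open>z ^ M = 1\<close>, and
  \<open>z \<noteq> 1\<close> because the exponents differ by less than \<open>M\<close>.\<close>

lemma sum_roots_of_unity:
  assumes "m < M" "l < M"
  shows "(\<Sum>r<M. cis (2 * pi * real r / real M) ^ m * cnj (cis (2 * pi * real r / real M) ^ l)) =
         (if m = l then of_nat M else 0)"
proof -
  define z where "z = cis (2 * pi * (real m - real l) / M)"
  have M: "M > 0" using assms by simp
  have "cis (2 * pi * real r / real M) ^ m * cnj (cis (2 * pi * real r / real M) ^ l) = z ^ r" for r :: nat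
    by (simp add: z_def Complex.DeMoivre cis_cnj cis_mult diff_divide_distrib algebra_simps
        flip: complex_cnj_power)
  then have eq: "(\<Sum>r<M. cis (2 * pi * real r / real M) ^ m * cnj (cis (2 * pi * real r / real M) ^ l)) = (\<Sum>r<M. z ^ r)"
    by simp
  show ?thesis
  proof (cases "m = l")
    case True
    then show ?thesis unfolding eq by (simp add: z_def)
  next
    case False
    have "z \<noteq> 1"
    proof
      assume "z = 1"
      then have "cos (2 * pi * (real m - real l) / M) = 1" unfolding z_def
        by (metis cis.simps(1) one_complex.simps(1))
      then obtain n :: int where n: "2 * pi * (real m - real l) / M = real_of_int n * 2 * pi"
        using cos_one_2pi_int by blast
      then have "(2 * pi) * (real m - real l) = (2 * pi) * (n * M)" using M by (simp add: field_simps)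
      then have "real m - real l = n * M" by (subst (asm) mult_left_cancel) auto
      then have *: "int m - int l = n * int M"
        by (metis of_int_diff of_int_eq_iff of_int_mult of_int_of_nat_eq)
      moreover have "\<bar>int m - int l\<bar> < int M" using assms by linarith
      ultimately have "\<bar>n\<bar> * int M < 1 * int M" by (simp add: abs_mult)
      then have "n = 0" using M by simp
      with * False show False by simp
    qed
    moreover have "z ^ M = 1"
    proof -
      have "z ^ M = cis (2 * pi * (real m - real l))" unfolding z_def Complex.DeMoivre using M by simp
      also have "\<dots> = cis (2 * pi * of_int (int m - int l))" by simp
      also have "\<dots> = 1" by (rule cis_multiple_2pi) auto
      finally show ?thesis .
    qed
    ultimately show ?thesis unfolding eq using False by (simp add: geometric_sum)
  qed
qed

text \<open>Expanding the squared norms as inner products and summing over the roots first leaves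
  only the diagonal terms. This finite version replaces an integral over the circle.\<close>

lemma parseval_roots_of_unity:
  fixes v :: "nat \<Rightarrow> 'a::complex_hilbert_space"
  shows "(\<Sum>r<M. (norm (\<Sum>m<M. cis (2 * pi * real r / real M) ^ m *\<^sub>C v m))\<^sup>2) = M * (\<Sum>m<M. (norm (v m))\<^sup>2)"
proof -
  define w where "w r = cis (2 * pi * real r / real M)" for r
  have "complex_of_real (\<Sum>r<M. (norm (\<Sum>m<M. w r ^ m *\<^sub>C v m))\<^sup>2) =
        (\<Sum>r<M. \<Sum>m<M. \<Sum>l<M. w r ^ m * cnj (w r ^ l) * cinner (v m) (v l))"
    unfolding of_real_sum cinner_self[symmetric]
    by (intro sum.cong refl, simp only: cinner_sum_left, intro sum.cong refl)
       (simp add: cinner_sum_right cinner_scaleC_left cinner_scaleC_right sum_distrib_left mult_ac)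
  also have "\<dots> = (\<Sum>m<M. \<Sum>r<M. \<Sum>l<M. w r ^ m * cnj (w r ^ l) * cinner (v m) (v l))"
    by (rule sum.swap)
  also have "\<dots> = (\<Sum>m<M. \<Sum>l<M. \<Sum>r<M. w r ^ m * cnj (w r ^ l) * cinner (v m) (v l))"
    by (intro sum.cong refl sum.swap)
  also have "\<dots> = (\<Sum>m<M. \<Sum>l<M. (if m = l then of_nat M else 0) * cinner (v m) (v l))"
    by (intro sum.cong refl)
       (simp add: sum_distrib_right[symmetric] w_def sum_roots_of_unity del: complex_cnj_power)
  also have "\<dots> = (\<Sum>m<M. of_nat M * cinner (v m) (v m))"
    by (intro sum.cong refl) (simp add: if_distrib[of "\<lambda>x. x * _"] sum.delta cong: if_cong)
  also have "\<dots> = complex_of_real (M * (\<Sum>m<M. (norm (v m))\<^sup>2))"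
    by (simp add: cinner_self sum_distrib_left)
  finally show ?thesis unfolding w_def of_real_eq_iff .
qed

text \<open>For \<open>\<omega>\<close> a root of unity put \<open>g(\<omega>) = \<Sum>j<N. \<omega>^(N-1-j) T^j x\<close>. The coefficients of \<open>q g\<close> at
  \<open>\<omega>^m\<close> with \<open>D \<le> m < N\<close> are \<open>T^(N-1-m) q(T) x\<close>, so Parseval gives
  \<open>(N - D) \<parallel>q(T) x\<parallel>\<^sup>2 \<le> S\<^sup>2 N \<parallel>x\<parallel>\<^sup>2\<close> for every \<open>N\<close>.\<close>

lemma isometry_polynomial_bound:
  fixes T :: "'a::complex_hilbert_space oper"
  assumes lin: "clinear_oper T" and iso: "\<And>x. norm (T x) = norm x"
    and S: "\<And>z. cmod z = 1 \<Longrightarrow> cmod (\<Sum>k\<le>D. b k * z ^ k) \<le> S"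
  shows "norm (\<Sum>k\<le>D. b k *\<^sub>C (blinfun_apply T ^^ k) x) \<le> S * norm x"
proof -
  let ?T = "\<lambda>k. blinfun_apply T ^^ k"
  define y where "y = (\<Sum>k\<le>D. b k *\<^sub>C ?T k x)"
  have S0: "S \<ge> 0" using S[of 1] by (meson norm_ge_zero norm_one order_trans)
  have isok: "norm (?T k u) = norm u" for k u by (induction k) (auto simp: iso)
  have sumk: "?T k (sum f A) = (\<Sum>i\<in>A. ?T k (f i))" for k and f :: "nat \<Rightarrow> 'a" and A
    by (induction k) (auto simp: blinfun.sum_right)
  have scak: "?T k (c *\<^sub>C u) = c *\<^sub>C ?T k u" for k c u
    using lin by (induction k) (auto simp: clinear_oper_def)
  have main: "(real N - real D) * (norm y)\<^sup>2 \<le> real N * (S * norm x)\<^sup>2" if ND: "N \<ge> D" for N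
  proof -
    \<comment> \<open>The product of a polynomial of degree at most \<open>D\<close> with one of
      degree below \<open>N\<close> has all its coefficients below \<open>M\<close>, so the Fourier
      sums of length \<open>M\<close> see no wrap-around.\<close>
    define M where "M = Suc (N + D)"
    define v where "v m = (if m < N then ?T (N - 1 - m) x else 0)" for m
    \<comment> \<open>The convolution of \<open>b\<close> and \<open>v\<close>, that is, the
      coefficients of the product of the two polynomials.\<close>
    define w where "w m = (\<Sum>k\<le>D. if k \<le> m then b k *\<^sub>C v (m - k) else 0)" for m
    define z where "z r = cis (2 * pi * real r / real M)" for r
    have conv: "(\<Sum>m<M. c ^ m *\<^sub>C w m) = (\<Sum>k\<le>D. b k * c ^ k) *\<^sub>C (\<Sum>m<M. c ^ m *\<^sub>C v m)" for c
    proof -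
      have shift: "(\<Sum>m<M. c ^ m *\<^sub>C (if k \<le> m then b k *\<^sub>C v (m - k) else 0)) =
            (\<Sum>m<M. (b k * c ^ k) *\<^sub>C c ^ m *\<^sub>C v m)" if "k \<le> D" for k
      proof -
        have "(\<Sum>m<M. c ^ m *\<^sub>C (if k \<le> m then b k *\<^sub>C v (m - k) else 0)) =
              (\<Sum>m\<in>{k..<M}. c ^ m *\<^sub>C b k *\<^sub>C v (m - k))"
          by (rule sum.mono_neutral_cong_right) auto
        also have "\<dots> = (\<Sum>m<M - k. (b k * c ^ k) *\<^sub>C c ^ m *\<^sub>C v m)"
          by (rule sum.reindex_bij_witness[of _ "\<lambda>m. m + k" "\<lambda>m. m - k"])
             (auto simp: scaleC_scaleC power_add[symmetric] mult_ac)
        also have "\<dots> = (\<Sum>m<M. (b k * c ^ k) *\<^sub>C c ^ m *\<^sub>C v m)"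
          by (rule sum.mono_neutral_left) (use that in \<open>auto simp: v_def M_def\<close>)
        finally show ?thesis .
      qed
      have dist: "(\<Sum>k\<in>K. f k) *\<^sub>C u = (\<Sum>k\<in>K. f k *\<^sub>C u)" for K :: "nat set" and f and u :: 'a
        by (induction K rule: infinite_finite_induct) (auto simp: scaleC_add_left)
      have "(\<Sum>m<M. c ^ m *\<^sub>C w m) =
            (\<Sum>k\<le>D. \<Sum>m<M. c ^ m *\<^sub>C (if k \<le> m then b k *\<^sub>C v (m - k) else 0))"
        unfolding w_def scaleC_sum_right by (rule sum.swap)
      also have "\<dots> = (\<Sum>k\<le>D. \<Sum>m<M. (b k * c ^ k) *\<^sub>C c ^ m *\<^sub>C v m)"
        by (rule sum.cong) (use shift in auto)
      also have "\<dots> = (\<Sum>k\<le>D. b k * c ^ k) *\<^sub>C (\<Sum>m<M. c ^ m *\<^sub>C v m)"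
        unfolding dist scaleC_sum_right by (rule sum.swap)
      finally show ?thesis .
    qed
    \<comment> \<open>For these \<open>m\<close> every \<open>m - k\<close> with
      \<open>k \<le> D\<close> lies in the support of \<open>v\<close>, so the convolution is
      complete and equals a power of the isometry applied to \<open>y\<close>.\<close>
    have wm: "norm (w m) = norm y" if "m \<in> {D..<N}" for m
    proof -
      have "w m = (\<Sum>k\<le>D. ?T (N - 1 - m) (b k *\<^sub>C ?T k x))"
        unfolding w_def
      proof (rule sum.cong)
        fix k assume k: "k \<in> {..D}"
        then have eq: "N - 1 - (m - k) = (N - 1 - m) + k" using that by auto
        have "v (m - k) = ?T (N - 1 - m) (?T k x)"
          unfolding v_def eq funpow_add o_apply using that k by auto
        then show "(if k \<le> m then b k *\<^sub>C v (m - k) else 0) = ?T (N - 1 - m) (b k *\<^sub>C ?T k x)"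
          using that k by (simp add: scak)
      qed simp
      also have "\<dots> = ?T (N - 1 - m) y" by (simp add: y_def sumk)
      finally show ?thesis by (simp add: isok)
    qed
    have "M * ((real N - real D) * (norm y)\<^sup>2) = M * (\<Sum>m\<in>{D..<N}. (norm (w m))\<^sup>2)"
      using ND by (simp add: wm of_nat_diff)
    also have "\<dots> \<le> M * (\<Sum>m<M. (norm (w m))\<^sup>2)"
      by (intro mult_left_mono sum_mono2) (auto simp: M_def)
    also have "\<dots> = (\<Sum>r<M. (norm (\<Sum>m<M. z r ^ m *\<^sub>C w m))\<^sup>2)"
      unfolding z_def by (rule parseval_roots_of_unity[symmetric])
    also have "\<dots> \<le> (\<Sum>r<M. (S * norm (\<Sum>m<M. z r ^ m *\<^sub>C v m))\<^sup>2)"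
      unfolding conv norm_scaleC
      by (intro sum_mono power_mono mult_right_mono S) (auto simp: z_def)
    also have "\<dots> = S\<^sup>2 * (\<Sum>r<M. (norm (\<Sum>m<M. z r ^ m *\<^sub>C v m))\<^sup>2)"
      by (simp add: power_mult_distrib sum_distrib_left)
    also have "\<dots> = S\<^sup>2 * (M * (\<Sum>m<M. (norm (v m))\<^sup>2))"
      unfolding z_def by (subst parseval_roots_of_unity) simp
    also have "(\<Sum>m<M. (norm (v m))\<^sup>2) = (\<Sum>m<N. (norm x)\<^sup>2)"
      by (rule sum.mono_neutral_cong_right) (auto simp: M_def v_def isok)
    finally show ?thesis by (simp add: M_def power_mult_distrib mult_ac)
  qed
  \<comment> \<open>Division by the length and passage to the limit: \<open>D\<close> is fixed, so
    the proportion of complete coefficients tends to 1.\<close>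
  have "(norm y)\<^sup>2 \<le> (S * norm x)\<^sup>2"
  proof (rule LIMSEQ_le)
    show "(\<lambda>N. (1 - real D * inverse (real (Suc N))) * (norm y)\<^sup>2) \<longlonglongrightarrow> (norm y)\<^sup>2"
      using tendsto_mult_right[OF tendsto_diff[OF tendsto_const tendsto_mult_left[OF
            LIMSEQ_inverse_real_of_nat]], of 1 "real D" "(norm y)\<^sup>2"] by simp
    show "(\<lambda>N. (S * norm x)\<^sup>2) \<longlonglongrightarrow> (S * norm x)\<^sup>2" by simp
    show "\<exists>K. \<forall>N\<ge>K. (1 - real D * inverse (real (Suc N))) * (norm y)\<^sup>2 \<le> (S * norm x)\<^sup>2"
    proof (intro exI allI impI)
      fix N assume "N \<ge> D"
      then have "(real (Suc N) - real D) * (norm y)\<^sup>2 \<le> real (Suc N) * (S * norm x)\<^sup>2"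
        by (intro main) simp
      then have "((real (Suc N) - real D) * (norm y)\<^sup>2) / real (Suc N) \<le> (S * norm x)\<^sup>2"
        by (simp add: divide_le_eq mult.commute)
      moreover have "(1 - real D * inverse (real (Suc N))) * (norm y)\<^sup>2 =
            ((real (Suc N) - real D) * (norm y)\<^sup>2) / real (Suc N)"
        by (simp add: field_simps)
      ultimately show "(1 - real D * inverse (real (Suc N))) * (norm y)\<^sup>2 \<le> (S * norm x)\<^sup>2" by simp
    qed
  qed
  then show ?thesis unfolding y_def[symmetric]
    by (rule power2_le_imp_le) (simp add: S0)
qed

section \<open>Norm bound and evaluation for Laurent polynomials of a unitary\<close>

lemma oscale_apply [simp]: "blinfun_apply (oscale c T) x = c *\<^sub>C blinfun_apply T x"
  by transfer rule

lemma blinfun_apply_sum: "blinfun_apply (sum f A) x = (\<Sum>i\<in>A. blinfun_apply (f i) x)"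
  by (induction A rule: infinite_finite_induct) (auto simp: blinfun.add_left)

lemma sum_int_interval_shift:
  fixes f :: "int \<Rightarrow> 'b::comm_monoid_add"
  shows "(\<Sum>k = - int N..int N. f k) = (\<Sum>k\<le>2 * N. f (int k - int N))"
  by (rule sum.reindex_bij_witness[of _ "\<lambda>k. int k - int N" "\<lambda>k. nat (k + int N)"]) auto

text \<open>Applying the isometry \<open>U\<close> to the power \<open>N\<close> clears the negative
  exponents without changing norms, and \<open>z ^ N\<close> has modulus 1 on the circle. The
  polynomial bound of degree \<open>2 * N\<close> then applies.\<close>

lemma norm_laurent_oper_le:
  assumes U: "unitary_oper U" and S: "\<And>z. cmod z = 1 \<Longrightarrow> cmod (laurent N a z) \<le> S"
  shows "norm (laurent_oper N a U) \<le> S"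
proof (rule norm_blinfun_bound)
  show "S \<ge> 0" using S[of 1] by (meson norm_ge_zero norm_one order_trans)
  fix x
  let ?U = "\<lambda>k. blinfun_apply U ^^ k"
  have lin: "clinear_oper U" and inv: "blinfun_apply U (blinfun_apply (adj U) u) = u" for u
    using U by (auto simp: unitary_oper_def) (metis blinfun_apply_blinfun_compose blinfun_apply_id_blinfun)
  have iso: "norm (blinfun_apply U u) = norm u" for u by (rule norm_unitary_oper[OF U])
  have isok: "norm (?U k u) = norm u" for k u by (induction k) (auto simp: iso)
  have sumk: "?U k (sum f A) = (\<Sum>i\<in>A. ?U k (f i))" for k and f :: "int \<Rightarrow> 'a" and A
    by (induction k) (auto simp: blinfun.sum_right)
  have scak: "?U k (c *\<^sub>C u) = c *\<^sub>C ?U k u" for k c u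
    using lin by (induction k) (auto simp: clinear_oper_def)
  have cancel: "?U j ((blinfun_apply (adj U) ^^ j) u) = u" for j u
  proof (induction j)
    case (Suc j)
    have "?U (Suc j) ((blinfun_apply (adj U) ^^ Suc j) u) =
        ?U j (blinfun_apply U (blinfun_apply (adj U) ((blinfun_apply (adj U) ^^ j) u)))"
      by (simp add: funpow_swap1)
    with Suc show ?case by (simp only: inv)
  qed simp
  have pw: "?U N (blinfun_apply (unitary_powi U k) x) = ?U (nat (int N + k)) x"
    if "k \<ge> - int N" for k
  proof (cases "k \<ge> 0")
    case True
    then have "nat (int N + k) = N + nat k" by auto
    then show ?thesis using True by (simp add: unitary_powi_def oprod_replicate_apply funpow_add)
  next
    case False
    define j where "j = nat (- k)"
    have "N = nat (int N + k) + j" using False that by (auto simp: j_def)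
    then have "?U N u = ?U (nat (int N + k)) (?U j u)" for u by (metis funpow_add o_apply)
    then show ?thesis using False
      by (simp add: unitary_powi_def oprod_replicate_apply j_def[symmetric] cancel)
  qed
  have "norm (blinfun_apply (laurent_oper N a U) x) = norm (?U N (blinfun_apply (laurent_oper N a U) x))"
    by (simp add: isok)
  also have "?U N (blinfun_apply (laurent_oper N a U) x) =
      (\<Sum>k = - int N..int N. a k *\<^sub>C ?U (nat (int N + k)) x)"
    by (simp add: laurent_oper_def blinfun_apply_sum sumk scak pw)
  also have "\<dots> = (\<Sum>k\<le>2 * N. a (int k - int N) *\<^sub>C ?U k x)"
    by (simp add: sum_int_interval_shift)
  also have "norm \<dots> \<le> S * norm x"
  proof (rule isometry_polynomial_bound[OF lin iso])
    fix z :: complex assume z: "cmod z = 1"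
    then have z0: "z \<noteq> 0" by auto
    have "(\<Sum>k\<le>2 * N. a (int k - int N) * z ^ k) = z ^ N * laurent N a z"
      unfolding laurent_def sum_int_interval_shift sum_distrib_left
      by (rule sum.cong) (use z0 in \<open>auto simp: power_int_diff\<close>)
    then show "cmod (\<Sum>k\<le>2 * N. a (int k - int N) * z ^ k) \<le> S"
      using S[OF z] z by (simp add: norm_mult norm_power)
  qed
  finally show "norm (blinfun_apply (laurent_oper N a U) x) \<le> S * norm x" .
qed

text \<open>Padding with zeros brings two Laurent polynomials to a common range of exponents, so
  that their difference is again of this form.\<close>

lemma laurent_pad:
  assumes "N \<le> M"
  shows "laurent N a = laurent M (\<lambda>k. if \<bar>k\<bar> \<le> int N then a k else 0)"
    and "laurent_oper N a U = laurent_oper M (\<lambda>k. if \<bar>k\<bar> \<le> int N then a k else 0) U"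
proof -
  show "laurent N a = laurent M (\<lambda>k. if \<bar>k\<bar> \<le> int N then a k else 0)"
    unfolding laurent_def
    by (rule ext, rule sum.mono_neutral_cong_left) (use assms in auto)
  have "oscale 0 T = 0" for T :: "'a oper" by (auto intro!: blinfun_eqI)
  then show "laurent_oper N a U = laurent_oper M (\<lambda>k. if \<bar>k\<bar> \<le> int N then a k else 0) U"
    unfolding laurent_oper_def
    by (intro sum.mono_neutral_cong_left) (use assms in auto)
qed

lemma laurent_diff: "laurent N (\<lambda>k. a k - b k) z = laurent N a z - laurent N b z"
  by (simp add: laurent_def sum_subtractf left_diff_distrib)

lemma laurent_oper_diff: "laurent_oper N (\<lambda>k. a k - b k) U = laurent_oper N a U - laurent_oper N b U"
proof -
  have "oscale (c - d) T = oscale c T - oscale d T" for c d and T :: "'a oper"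
    by (auto intro!: blinfun_eqI simp: blinfun.diff_left scaleC_diff_left)
  then show ?thesis by (simp add: laurent_oper_def sum_subtractf)
qed

text \<open>The norm bound, applied to the difference of an approximant and the limit polynomial,
  gives convergence along every approximating sequence; the constant sequence gives uniqueness. So
  the definite description has a value here.\<close>

lemma functional_calculus_laurent:
  assumes U: "unitary_oper U"
  shows "functional_calculus U (laurent N0 a0) = laurent_oper N0 a0 U"
  unfolding functional_calculus_def
proof (rule the_equality, intro allI impI)
  fix N :: "nat \<Rightarrow> nat" and a
  assume lim: "uniform_limit unit_circle (\<lambda>n. laurent (N n) (a n)) (laurent N0 a0) sequentially"
  show "(\<lambda>n. laurent_oper (N n) (a n) U) \<longlonglongrightarrow> laurent_oper N0 a0 U"
  proof (rule tendstoI)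
    fix e :: real assume e: "e > 0"
    then have "e / 2 > 0" by simp
    from uniform_limitD[OF lim this]
    show "\<forall>\<^sub>F n in sequentially. dist (laurent_oper (N n) (a n) U) (laurent_oper N0 a0 U) < e"
    proof eventually_elim
      case (elim n)
      define M where "M = max (N n) N0"
      let ?p = "\<lambda>(K::nat) b k. if \<bar>k\<bar> \<le> int K then b k else 0"
      have M: "N n \<le> M" "N0 \<le> M" by (auto simp: M_def)
      have "norm (laurent_oper M (\<lambda>k. ?p (N n) (a n) k - ?p N0 a0 k) U) \<le> e / 2"
      proof (rule norm_laurent_oper_le[OF U])
        fix z :: complex assume "cmod z = 1"
        then have "dist (laurent (N n) (a n) z) (laurent N0 a0 z) < e / 2" using elim by simp
        then show "cmod (laurent M (\<lambda>k. ?p (N n) (a n) k - ?p N0 a0 k) z) \<le> e / 2"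
          unfolding laurent_diff laurent_pad(1)[OF M(1), symmetric] laurent_pad(1)[OF M(2), symmetric]
          by (simp add: dist_norm)
      qed
      then show ?case using e
        unfolding laurent_oper_diff laurent_pad(2)[OF M(1), symmetric] laurent_pad(2)[OF M(2), symmetric]
        by (simp add: dist_norm)
    qed
  qed
next
  fix T assume T: "\<forall>N a. uniform_limit unit_circle (\<lambda>n. laurent (N n) (a n)) (laurent N0 a0) sequentially \<longrightarrow>
      (\<lambda>n. laurent_oper (N n) (a n) U) \<longlonglongrightarrow> T"
  have "(\<lambda>n::nat. laurent_oper N0 a0 U) \<longlonglongrightarrow> T"
    using T[rule_format, of "\<lambda>_. N0" "\<lambda>_. a0"] by (simp add: uniform_limit_const)
  then show "T = laurent_oper N0 a0 U" by (simp add: LIMSEQ_const_iff)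
qed

lemma functional_calculus_power:
  assumes "unitary_oper U"
  shows "functional_calculus U (\<lambda>z. z ^ k) = oprod (replicate k U)"
proof -
  let ?a = "\<lambda>j. if j = int k then 1 else 0 :: complex"
  have "laurent k ?a = (\<lambda>z. z ^ k)"
    unfolding laurent_def by (auto simp: if_distrib[of "\<lambda>x. x * _"] sum.delta cong: if_cong)
  moreover have "laurent_oper k ?a U = oprod (replicate k U)"
  proof -
    have "oscale 0 T = 0" "oscale 1 T = T" for T :: "'a oper" by (auto intro!: blinfun_eqI)
    then have "laurent_oper k ?a U = (\<Sum>j = - int k..int k. if j = int k then unitary_powi U j else 0)"
      unfolding laurent_oper_def by (intro sum.cong) auto
    then show ?thesis by (simp add: sum.delta unitary_powi_def)
  qed
  ultimately show ?thesis using functional_calculus_laurent[OF assms, of k ?a] by simp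
qed

lemma spectral_prob_measure_moment:
  assumes "unitary_oper U" "spectral_prob_measure E U M"
  shows "E (oprod (replicate k U)) = (\<integral>\<xi>. \<xi> ^ k \<partial>M)"
proof -
  have "continuous_on unit_circle (\<lambda>z. z ^ k :: complex)" by (intro continuous_intros)
  then show ?thesis
    using assms(2) functional_calculus_power[OF assms(1), of k] by (auto simp: spectral_prob_measure_def)
qed

subsection \<open>Measures on the circle\<close>

lemma circle_prob_measureD:
  assumes "circle_prob_measure M"
  shows "prob_space M" "sets M = sets (restrict_space borel unit_circle)" "space M = unit_circle"
  using assms sets_eq_imp_space_eq[of M "restrict_space borel unit_circle"]
  by (auto simp: circle_prob_measure_def space_restrict_space)

lemma integrable_circle:
  fixes f :: "complex \<Rightarrow> 'b::{banach, second_countable_topology}"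
  assumes M: "circle_prob_measure M" and f: "continuous_on unit_circle f"
  shows "integrable M f"
proof -
  interpret prob_space M using circle_prob_measureD(1)[OF M] .
  have "f \<in> borel_measurable (restrict_space borel unit_circle)"
    by (rule borel_measurable_continuous_on_restrict[OF f])
  then have "f \<in> borel_measurable M"
    using measurable_cong_sets[OF circle_prob_measureD(2)[OF M] refl] by blast
  moreover obtain B where "\<forall>z\<in>unit_circle. norm (f z) \<le> B"
    using compact_imp_bounded[OF compact_continuous_image[OF f compact_sphere]]
    unfolding bounded_iff by blast
  ultimately show ?thesis
    by (intro integrable_const_bound[of f B]) (auto simp: circle_prob_measureD(3)[OF M])
qed

lemma moment_uniform_circle:
  assumes "k \<ge> 1"
  shows "(\<integral>\<xi>. \<xi> ^ k \<partial>uniform_circle) = 0"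
proof -
  have k: "real k > 0" using assms by simp
  have cont: "continuous_on S (\<lambda>x. cis (real k * x))" for S by (intro continuous_intros)
  have meas: "(\<lambda>x. cis (real k * x)) \<in> borel_measurable borel"
    by (intro borel_measurable_continuous_onI cont)
  have "cis \<in> borel_measurable borel"
    by (intro borel_measurable_continuous_onI continuous_intros)
  then have cis: "cis \<in> measurable (uniform_measure lborel {0..<2 * pi}) (restrict_space borel unit_circle)"
    by (intro measurable_restrict_space2) (auto simp: measurable_def uniform_measure_def)
  have "(\<lambda>\<xi>::complex. \<xi> ^ k) \<in> borel_measurable (restrict_space borel unit_circle)"
    by (intro borel_measurable_continuous_on_restrict continuous_intros)
  then have "(\<integral>\<xi>. \<xi> ^ k \<partial>uniform_circle) = (\<integral>x. cis x ^ k \<partial>uniform_measure lborel {0..<2 * pi})"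
    unfolding uniform_circle_def by (intro integral_distr cis)
  also have "\<dots> = (\<integral>x. cis (real k * x) \<partial>density lborel (\<lambda>x. ennreal (indicator {0..<2 * pi} x / (2 * pi))))"
  proof -
    have "indicator {0..<2 * pi} x / emeasure lborel {0..<2 * pi} = ennreal (indicator {0..<2 * pi} x / (2 * pi))"
      for x :: real
      using divide_ennreal[of 1 "2 * pi"] by (cases "x \<in> {0..<2 * pi}") simp_all
    then show ?thesis unfolding uniform_measure_def Complex.DeMoivre by simp
  qed
  also have "\<dots> = (\<integral>x. (indicator {0..<2 * pi} x / (2 * pi)) *\<^sub>R cis (real k * x) \<partial>lborel)"
    by (rule integral_density) (use meas in auto)
  \<comment> \<open>The right endpoint is a null set; adding it gives the closed interval of the
    fundamental theorem of calculus.\<close>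
  also have "\<dots> = (\<integral>x. (1 / (2 * pi)) *\<^sub>R (indicator {0..2 * pi} x *\<^sub>R cis (real k * x)) \<partial>lborel)"
  proof (rule integral_cong_AE)
    show "AE x in lborel. (indicator {0..<2 * pi} x / (2 * pi)) *\<^sub>R cis (real k * x) =
        (1 / (2 * pi)) *\<^sub>R (indicator {0..2 * pi} x *\<^sub>R cis (real k * x))"
      using AE_lborel_singleton[of "2 * pi"] by eventually_elim (auto simp: indicator_def)
  qed (use meas in auto)
  also have "\<dots> = (1 / (2 * pi)) *\<^sub>R (\<integral>x. indicator {0..2 * pi} x *\<^sub>R cis (real k * x) \<partial>lborel)"
    by (simp only: integral_scaleR_right)
  also have "(\<integral>x. indicator {0..2 * pi} x *\<^sub>R cis (real k * x) \<partial>lborel) =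
      cis (real k * (2 * pi)) / (\<i> * k) - cis (real k * 0) / (\<i> * k)"
  proof (rule integral_FTC_atLeastAtMost)
    fix x :: real
    have "((\<lambda>z. exp (\<i> * real k * z)) has_field_derivative \<i> * real k * exp (\<i> * real k * of_real x))
        (at (complex_of_real x))"
      by (auto intro!: derivative_eq_intros)
    from has_vector_derivative_real_field[OF this]
    have "((\<lambda>x. cis (real k * x)) has_vector_derivative (\<i> * real k * cis (real k * x))) (at x)"
      by (simp add: cis_conv_exp mult.assoc)
    from has_vector_derivative_divide[OF this, of "\<i> * k"] k
    have "((\<lambda>x. cis (real k * x) / (\<i> * k)) has_vector_derivative cis (real k * x)) (at x)"
      by (simp add: scaleR_conv_of_real)
    then show "((\<lambda>x. cis (real k * x) / (\<i> * k)) has_vector_derivative cis (real k * x)) (at x within {0..2 * pi})"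
      by (rule has_vector_derivative_at_within)
  qed (use cont in auto)
  also have "cis (real k * (2 * pi)) = 1"
    using cis_multiple_2pi[of "real k"] by (simp add: mult_ac)
  finally show ?thesis by simp
qed

text \<open>Closure under equality on the circle is built in because conjugation agrees with
  \<open>z powi (-1)\<close> only there.\<close>

inductive trig_polynomial :: "(complex \<Rightarrow> complex) \<Rightarrow> bool" where
  trig_powi: "trig_polynomial (\<lambda>z. z powi k)"
| trig_add: "trig_polynomial f \<Longrightarrow> trig_polynomial g \<Longrightarrow> trig_polynomial (\<lambda>z. f z + g z)"
| trig_scale: "trig_polynomial f \<Longrightarrow> trig_polynomial (\<lambda>z. c * f z)"
| trig_cong: "trig_polynomial f \<Longrightarrow> (\<And>z. z \<in> unit_circle \<Longrightarrow> f z = g z) \<Longrightarrow> trig_polynomial g"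

lemma trig_mult:
  assumes "trig_polynomial f" "trig_polynomial g"
  shows "trig_polynomial (\<lambda>z. f z * g z)"
  using assms(1)
proof (induction rule: trig_polynomial.induct)
  case (trig_powi k)
  show ?case using assms(2)
  proof (induction rule: trig_polynomial.induct)
    case (trig_powi l)
    have "z powi (k + l) = z powi k * z powi l" if "z \<in> unit_circle" for z :: complex
      using that by (intro power_int_add) auto
    then show ?case by (rule trig_cong[OF trig_polynomial.trig_powi[of "k + l"]])
  next
    case (trig_add f g)
    from trig_polynomial.trig_add[OF trig_add(3,4)] show ?case unfolding distrib_left .
  next
    case (trig_scale f c)
    from trig_polynomial.trig_scale[OF trig_scale(2), of c] show ?case
      unfolding mult.left_commute[of _ c] .
  next
    case (trig_cong f g)
    show ?case by (rule trig_polynomial.trig_cong[OF trig_cong(3)]) (simp add: trig_cong(2))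
  qed
next
  case (trig_add f g)
  from trig_polynomial.trig_add[OF trig_add(3,4)] show ?case unfolding distrib_right .
next
  case (trig_scale f c)
  from trig_polynomial.trig_scale[OF trig_scale(2), of c] show ?case unfolding mult.assoc .
next
  case (trig_cong f h)
  show ?case by (rule trig_polynomial.trig_cong[OF trig_cong(3)]) (simp add: trig_cong(2))
qed

text \<open>Connects the real Stone-Weierstrass theorem with moments: real polynomials are generated
  by real linear functionals, and on the circle these are combinations of \<open>z\<close> and its
  inverse.\<close>

lemma trig_polynomial_of_real:
  assumes "real_polynomial_function p"
  shows "trig_polynomial (\<lambda>z. complex_of_real (p z))"
  using assms
proof (induction rule: real_polynomial_function.induct)
  case (linear f)
  interpret bounded_linear f by fact
  \<comment> \<open>The coefficients come from Re z = (z + 1/z) / 2 and Im z = (z - 1/z) / (2 i),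
    valid on the circle.\<close>
  let ?c = "(of_real (f 1) - \<i> * of_real (f \<i>)) / 2" and ?d = "(of_real (f 1) + \<i> * of_real (f \<i>)) / 2"
  have "trig_polynomial (\<lambda>z. ?c * z powi 1 + ?d * z powi (-1))"
    by (intro trig_add trig_scale trig_powi)
  then show ?case
  proof (rule trig_cong)
    fix z :: complex assume "z \<in> unit_circle"
    then have "inverse z = cnj z" by (simp add: inverse_complex_def complex_eq_iff cmod_def)
    then have inv: "z powi (-1) = cnj z" by (simp only: power_int_minus power_int_1_right)
    have "f z = Re z * f 1 + Im z * f \<i>"
    proof -
      have "z = Re z *\<^sub>R 1 + Im z *\<^sub>R \<i>" by (simp add: complex_eq_iff)
      then have "f z = f (Re z *\<^sub>R 1 + Im z *\<^sub>R \<i>)" by simp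
      then show ?thesis by (simp only: add scaleR real_scaleR_def)
    qed
    then have "?c * z + ?d * cnj z = of_real (f z)"
      by (intro complex_eqI) (simp_all add: algebra_simps diff_divide_distrib add_divide_distrib)
    then show "?c * z powi 1 + ?d * z powi (-1) = of_real (f z)"
      by (simp only: inv power_int_1_right)
  qed
next
  case (const c)
  show ?case by (rule trig_cong[OF trig_scale[OF trig_powi[of 0], of "of_real c"]]) simp
next
  case (add f g)
  then show ?case by (simp add: trig_add)
next
  case (mult f g)
  then show ?case by (simp add: trig_mult)
qed

lemma trig_polynomial_continuous: "trig_polynomial f \<Longrightarrow> continuous_on unit_circle f"
proof (induction rule: trig_polynomial.induct)
  case (trig_powi k)
  show ?case by (intro continuous_on_power_int continuous_intros) auto
next
  case (trig_cong f g)
  then show ?case by (metis continuous_on_cong)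
qed (auto intro!: continuous_intros)

text \<open>Positive exponents are the hypothesis, exponent 0 is total mass 1, and negative
  exponents follow by conjugation, since inverse and conjugate agree on the circle.\<close>

lemma integral_trig_tendsto:
  assumes M: "\<And>n. circle_prob_measure (M n)"
    and lim: "\<And>k. k \<ge> 1 \<Longrightarrow> (\<lambda>n. \<integral>\<xi>. \<xi> ^ k \<partial>M n) \<longlonglongrightarrow> 0"
    and f: "trig_polynomial f"
  shows "(\<lambda>n. \<integral>\<xi>. f \<xi> \<partial>M n) \<longlonglongrightarrow> (\<integral>\<xi>. f \<xi> \<partial>uniform_circle)"
proof -
  note U = circle_prob_measure_uniform_circle
  have int: "integrable N g" if "trig_polynomial g" "circle_prob_measure N" for N g
    using integrable_circle[OF that(2) trig_polynomial_continuous[OF that(1)]] .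
  show ?thesis using f
  proof (induction rule: trig_polynomial.induct)
    case (trig_powi k)
    consider "k = 0" | "k > 0" | "k < 0" by linarith
    then show ?case
    proof cases
      case 1
      have "measure N (space N) = 1" if "circle_prob_measure N" for N
        using circle_prob_measureD(1)[OF that] by (rule prob_space.prob_space)
      then show ?thesis using 1 M U by simp
    next
      case 2
      then have "\<xi> powi k = \<xi> ^ nat k" for \<xi> :: complex by (simp add: power_int_def)
      then show ?thesis using lim[of "nat k"] moment_uniform_circle[of "nat k"] 2 by simp
    next
      case 3
      have conj: "(\<integral>\<xi>. \<xi> powi k \<partial>N) = cnj (\<integral>\<xi>. \<xi> ^ nat (- k) \<partial>N)" if "circle_prob_measure N" for N
      proof -
        have "\<xi> powi k = cnj (\<xi> ^ nat (- k))" if "\<xi> \<in> unit_circle" for \<xi> :: complex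
        proof -
          have "inverse \<xi> = cnj \<xi>" using that by (simp add: inverse_complex_def complex_eq_iff cmod_def)
          then show ?thesis using 3 by (simp add: power_int_def)
        qed
        then have "(\<integral>\<xi>. \<xi> powi k \<partial>N) = (\<integral>\<xi>. cnj (\<xi> ^ nat (- k)) \<partial>N)"
          by (intro Bochner_Integration.integral_cong) (auto simp: circle_prob_measureD(3)[OF that])
        then show ?thesis by (simp only: Bochner_Integration.integral_cnj)
      qed
      have "(\<lambda>n. cnj (\<integral>\<xi>. \<xi> ^ nat (- k) \<partial>M n)) \<longlonglongrightarrow> cnj 0"
        by (intro tendsto_cnj lim) (use 3 in auto)
      then show ?thesis using moment_uniform_circle[of "nat (- k)"] 3 by (simp add: conj M U)
    qed
  next
    case (trig_add f g)
    then show ?case by (simp add: int M U tendsto_add)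
  next
    case (trig_scale f c)
    then show ?case by (simp add: tendsto_mult_left)
  next
    case (trig_cong f g)
    have "(\<integral>\<xi>. g \<xi> \<partial>N) = (\<integral>\<xi>. f \<xi> \<partial>N)" if "circle_prob_measure N" for N
      by (intro Bochner_Integration.integral_cong) (auto simp: circle_prob_measureD(3)[OF that] trig_cong)
    then show ?case using trig_cong M U by simp
  qed
qed

text \<open>Replacing \<open>f\<close> by a uniformly close polynomial costs at most
  \<open>e / 3\<close> under every probability measure, and the polynomial is handled through its
  Fourier modes.\<close>

lemma circle_weak_conv_if_moments:
  assumes M: "\<And>n. circle_prob_measure (M n)"
    and lim: "\<And>k. k \<ge> 1 \<Longrightarrow> (\<lambda>n. \<integral>\<xi>. \<xi> ^ k \<partial>M n) \<longlonglongrightarrow> 0"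
  shows "circle_weak_conv M uniform_circle"
  unfolding circle_weak_conv_def
proof (intro allI impI)
  fix f :: "complex \<Rightarrow> real" assume f: "continuous_on unit_circle f"
  note U = circle_prob_measure_uniform_circle
  show "(\<lambda>n. \<integral>\<xi>. f \<xi> \<partial>M n) \<longlonglongrightarrow> (\<integral>\<xi>. f \<xi> \<partial>uniform_circle)"
  proof (rule tendstoI)
    fix e :: real assume e: "e > 0"
    then obtain p where p: "real_polynomial_function p"
      and fp: "\<And>z. z \<in> unit_circle \<Longrightarrow> \<bar>f z - p z\<bar> < e / 3"
      using Stone_Weierstrass_real_polynomial_function[OF compact_sphere f, of "e / 3"] by auto
    have contp: "continuous_on unit_circle p"
      using p by (simp add: continuous_on_polymonial_function real_polynomial_function_eq)
    have approx: "\<bar>(\<integral>\<xi>. f \<xi> \<partial>N) - (\<integral>\<xi>. p \<xi> \<partial>N)\<bar> \<le> e / 3" if N: "circle_prob_measure N" for N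
    proof -
      interpret prob_space N by (rule circle_prob_measureD(1)[OF N])
      have int: "integrable N f" "integrable N p" using integrable_circle[OF N] f contp by auto
      have "\<bar>(\<integral>\<xi>. f \<xi> \<partial>N) - (\<integral>\<xi>. p \<xi> \<partial>N)\<bar> = \<bar>\<integral>\<xi>. f \<xi> - p \<xi> \<partial>N\<bar>" using int by simp
      also have "\<dots> \<le> (\<integral>\<xi>. \<bar>f \<xi> - p \<xi>\<bar> \<partial>N)" by (rule integral_abs_bound)
      also have "\<dots> \<le> (\<integral>\<xi>. e / 3 \<partial>N)"
        by (intro integral_mono) (use int fp in \<open>auto simp: circle_prob_measureD(3)[OF N] less_imp_le\<close>)
      finally show ?thesis by (simp add: prob_space)
    qed
    have "(\<lambda>n. Re (\<integral>\<xi>. complex_of_real (p \<xi>) \<partial>M n)) \<longlonglongrightarrow> Re (\<integral>\<xi>. complex_of_real (p \<xi>) \<partial>uniform_circle)"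
      by (intro tendsto_Re integral_trig_tendsto M lim trig_polynomial_of_real p)
    then have "(\<lambda>n. \<integral>\<xi>. p \<xi> \<partial>M n) \<longlonglongrightarrow> (\<integral>\<xi>. p \<xi> \<partial>uniform_circle)" by simp
    from tendstoD[OF this, of "e / 3"] e
    have "\<forall>\<^sub>F n in sequentially. dist (\<integral>\<xi>. p \<xi> \<partial>M n) (\<integral>\<xi>. p \<xi> \<partial>uniform_circle) < e / 3" by simp
    then show "\<forall>\<^sub>F n in sequentially. dist (\<integral>\<xi>. f \<xi> \<partial>M n) (\<integral>\<xi>. f \<xi> \<partial>uniform_circle) < e"
    proof eventually_elim
      case (elim n)
      then show ?case using approx[OF M[of n]] approx[OF U] unfolding dist_real_def by linarith
    qed
  qed
qed

lemma circle_weak_conv_iff_moments: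
  assumes M: "\<And>n. n \<ge> 1 \<Longrightarrow> circle_prob_measure (M n)"
  shows "circle_weak_conv M uniform_circle \<longleftrightarrow> (\<forall>k\<ge>1. (\<lambda>n. \<integral>\<xi>. \<xi> ^ k \<partial>M n) \<longlonglongrightarrow> 0)"
proof
  assume weak: "circle_weak_conv M uniform_circle"
  show "\<forall>k\<ge>1. (\<lambda>n. \<integral>\<xi>. \<xi> ^ k \<partial>M n) \<longlonglongrightarrow> 0"
  proof (intro allI impI)
    fix k :: nat assume k: "k \<ge> 1"
    have cont: "continuous_on unit_circle (\<lambda>\<xi>::complex. \<xi> ^ k)" by (intro continuous_intros)
    have int: "integrable N (\<lambda>\<xi>. \<xi> ^ k)" if "circle_prob_measure N" for N
      using that by (intro integrable_circle continuous_intros)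
    have "(\<lambda>n. \<integral>\<xi>. Re (\<xi> ^ k) \<partial>M n) \<longlonglongrightarrow> (\<integral>\<xi>. Re (\<xi> ^ k) \<partial>uniform_circle)"
      by (rule weak[unfolded circle_weak_conv_def, rule_format, OF continuous_on_Re[OF cont]])
    moreover have "(\<lambda>n. \<integral>\<xi>. Im (\<xi> ^ k) \<partial>M n) \<longlonglongrightarrow> (\<integral>\<xi>. Im (\<xi> ^ k) \<partial>uniform_circle)"
      by (rule weak[unfolded circle_weak_conv_def, rule_format, OF continuous_on_Im[OF cont]])
    moreover have "(\<integral>\<xi>. Re (\<xi> ^ k) \<partial>N) = Re (\<integral>\<xi>. \<xi> ^ k \<partial>N)"
      "(\<integral>\<xi>. Im (\<xi> ^ k) \<partial>N) = Im (\<integral>\<xi>. \<xi> ^ k \<partial>N)" if "circle_prob_measure N" for N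
      by (rule integral_Re[OF int[OF that]], rule integral_Im[OF int[OF that]])
    ultimately have "(\<lambda>n. Complex (\<integral>\<xi>. Re (\<xi> ^ k) \<partial>M n) (\<integral>\<xi>. Im (\<xi> ^ k) \<partial>M n)) \<longlonglongrightarrow> Complex 0 0"
      using moment_uniform_circle[OF k] circle_prob_measure_uniform_circle
      by (intro tendsto_Complex) simp_all
    moreover have "\<forall>\<^sub>F n in sequentially. Complex (\<integral>\<xi>. Re (\<xi> ^ k) \<partial>M n) (\<integral>\<xi>. Im (\<xi> ^ k) \<partial>M n) = (\<integral>\<xi>. \<xi> ^ k \<partial>M n)"
      using eventually_ge_at_top[of 1]
      by eventually_elim (simp only: integral_Re[OF int[OF M]] integral_Im[OF int[OF M]] complex_surj)
    moreover have "Complex 0 0 = 0" by (simp add: complex_eq_iff)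
    ultimately show "(\<lambda>n. \<integral>\<xi>. \<xi> ^ k \<partial>M n) \<longlonglongrightarrow> 0"
      by (simp only: tendsto_cong)
  qed
next
  assume lim: "\<forall>k\<ge>1. (\<lambda>n. \<integral>\<xi>. \<xi> ^ k \<partial>M n) \<longlonglongrightarrow> 0"
  \<comment> \<open>Nothing is known about \<open>M 0\<close>, so the criterion is applied to the
    shifted sequence and the shift is undone afterwards.\<close>
  have weak: "circle_weak_conv (\<lambda>n. M (Suc n)) uniform_circle"
  proof (rule circle_weak_conv_if_moments)
    show "(\<lambda>n. \<integral>\<xi>. \<xi> ^ k \<partial>M (Suc n)) \<longlonglongrightarrow> 0" if "k \<ge> 1" for k
      by (rule LIMSEQ_Suc) (use lim that in simp)
  qed (simp add: M)
  show "circle_weak_conv M uniform_circle"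
    unfolding circle_weak_conv_def
    by (intro allI impI, rule LIMSEQ_imp_Suc, rule weak[unfolded circle_weak_conv_def, rule_format])
qed

text \<open>The functions \<open>max 0 (1 - real n * infdist \<xi> F)\<close> are continuous and
  tend to the indicator of a closed \<open>F\<close>, so the measures agree on closed sets, an
  intersection-stable generator. Pushing forward to the plane makes the Borel sets of the whole
  plane available.\<close>

lemma circle_prob_measure_eqI:
  assumes M: "circle_prob_measure M" and N: "circle_prob_measure N"
    and eq: "\<And>f :: complex \<Rightarrow> real. continuous_on unit_circle f \<Longrightarrow> (\<integral>\<xi>. f \<xi> \<partial>M) = (\<integral>\<xi>. f \<xi> \<partial>N)"
  shows "M = N"
proof -
  have id: "(\<lambda>x. x) \<in> measurable K borel" if "circle_prob_measure K" for K
  proof -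
    have "(\<lambda>x::complex. x) \<in> measurable (restrict_space borel unit_circle) borel"
      by (rule measurable_restrict_space1) simp
    then show ?thesis using measurable_cong_sets[OF circle_prob_measureD(2)[OF that] refl] by blast
  qed
  have push: "emeasure (distr K borel (\<lambda>x. x)) B = emeasure K (B \<inter> unit_circle)"
    if "circle_prob_measure K" "B \<in> sets borel" for K B
    using emeasure_distr[OF id[OF that(1)] that(2)] by (simp add: circle_prob_measureD(3)[OF that(1)])
  have closed_sets: "F \<inter> unit_circle \<in> sets K" if "circle_prob_measure K" "F \<in> sets borel" for K F
    using that by (simp add: circle_prob_measureD(2) sets_restrict_space image_iff) blast
  have lim: "(\<lambda>n. \<integral>\<xi>. max 0 (1 - real n * infdist \<xi> F) \<partial>K) \<longlonglongrightarrow> measure K (F \<inter> unit_circle)"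
    if K: "circle_prob_measure K" and F: "closed F" "F \<noteq> {}" for K and F :: "complex set"
  proof -
    interpret prob_space K by (rule circle_prob_measureD(1)[OF K])
    have FK: "F \<inter> unit_circle \<in> sets K" using K F by (intro closed_sets) auto
    have "(\<lambda>n. \<integral>\<xi>. max 0 (1 - real n * infdist \<xi> F) \<partial>K) \<longlonglongrightarrow> (\<integral>\<xi>. indicator (F \<inter> unit_circle) \<xi> \<partial>K)"
    proof (rule integral_dominated_convergence[where w = "\<lambda>_. 1"])
      show "(\<lambda>\<xi>. max 0 (1 - real n * infdist \<xi> F)) \<in> borel_measurable K" for n
        by (intro borel_measurable_integrable integrable_circle[OF K] continuous_intros)
      show "AE \<xi> in K. (\<lambda>n. max 0 (1 - real n * infdist \<xi> F)) \<longlonglongrightarrow> indicator (F \<inter> unit_circle) \<xi>"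
      proof (rule AE_I2)
        fix \<xi> assume "\<xi> \<in> space K"
        then have circ: "\<xi> \<in> unit_circle" by (simp add: circle_prob_measureD(3)[OF K])
        show "(\<lambda>n. max 0 (1 - real n * infdist \<xi> F)) \<longlonglongrightarrow> indicator (F \<inter> unit_circle) \<xi>"
        proof (cases "\<xi> \<in> F")
          case True
          then show ?thesis using circ by simp
        next
          case False
          then have pos: "infdist \<xi> F > 0" using F infdist_pos_not_in_closed by blast
          obtain n0 where n0: "1 / infdist \<xi> F < real n0" using reals_Archimedean2 by blast
          have "max 0 (1 - real n * infdist \<xi> F) = 0" if "n \<ge> n0" for n
          proof -
            have "1 < real n0 * infdist \<xi> F" using n0 pos by (simp add: divide_less_eq)
            also have "\<dots> \<le> real n * infdist \<xi> F" using that pos by (intro mult_right_mono) auto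
            finally show ?thesis by simp
          qed
          then have "\<forall>\<^sub>F n in sequentially. max 0 (1 - real n * infdist \<xi> F) = 0"
            unfolding eventually_sequentially by blast
          then show ?thesis using False by (simp add: tendsto_eventually)
        qed
      qed
    qed (use FK in \<open>auto simp: infdist_nonneg\<close>)
    then show ?thesis using FK by simp
  qed
  have "distr M borel (\<lambda>x. x) = distr N borel (\<lambda>x. x)"
  proof (rule measure_eqI_generator_eq[of "Collect closed" UNIV _ _ "\<lambda>_. UNIV"])
    show "Int_stable (Collect closed :: complex set set)" by (auto simp: Int_stable_def)
    show "emeasure (distr M borel (\<lambda>x. x)) F = emeasure (distr N borel (\<lambda>x. x)) F"
      if "F \<in> Collect closed" for F
    \<comment> \<open>The empty set is separate: \<open>infdist\<close> to it is 0 by convention, so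
      the approximants would be constantly 1.\<close>
    proof (cases "F = {}")
      case False
      have "(\<lambda>n. \<integral>\<xi>. max 0 (1 - real n * infdist \<xi> F) \<partial>N) \<longlonglongrightarrow> measure M (F \<inter> unit_circle)"
        using lim[OF M, of F] that False
        by (subst eq[symmetric]) (auto intro!: continuous_intros)
      moreover have "(\<lambda>n. \<integral>\<xi>. max 0 (1 - real n * infdist \<xi> F) \<partial>N) \<longlonglongrightarrow> measure N (F \<inter> unit_circle)"
        using lim[OF N, of F] that False by auto
      ultimately have "measure M (F \<inter> unit_circle) = measure N (F \<inter> unit_circle)"
        by (rule LIMSEQ_unique)
      then have "emeasure M (F \<inter> unit_circle) = emeasure N (F \<inter> unit_circle)"
        using circle_prob_measureD(1)[OF M] circle_prob_measureD(1)[OF N]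
        by (simp add: finite_measure.emeasure_eq_measure prob_space.finite_measure)
      then show ?thesis using push[OF M, of F] push[OF N, of F] that by simp
    qed simp
    show "emeasure (distr M borel (\<lambda>x. x)) UNIV \<noteq> \<infinity>"
      using push[OF M, of UNIV] circle_prob_measureD[OF M]
      by (simp add: finite_measure.emeasure_eq_measure prob_space.finite_measure)
  qed (simp_all add: borel_eq_closed)
  show "M = N"
  proof (rule measure_eqI)
    show "sets M = sets N" by (simp add: circle_prob_measureD(2)[OF M] circle_prob_measureD(2)[OF N])
    fix A assume "A \<in> sets M"
    then obtain B where B: "B \<in> sets borel" "A = B \<inter> unit_circle"
      by (auto simp: circle_prob_measureD(2)[OF M] sets_restrict_space)
    then show "emeasure M A = emeasure N A"
      using push[OF M B(1)] push[OF N B(1)] \<open>distr M borel (\<lambda>x. x) = distr N borel (\<lambda>x. x)\<close> by simp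
  qed
qed

lemma circle_prob_measure_eq_uniform:
  assumes M: "circle_prob_measure M" and "\<And>k. k \<ge> 1 \<Longrightarrow> (\<integral>\<xi>. \<xi> ^ k \<partial>M) = 0"
  shows "M = uniform_circle"
proof (rule circle_prob_measure_eqI[OF M circle_prob_measure_uniform_circle])
  fix f :: "complex \<Rightarrow> real" assume f: "continuous_on unit_circle f"
  \<comment> \<open>Weak convergence of the constant sequence identifies the integrals under the two
    measures.\<close>
  have "circle_weak_conv (\<lambda>_. M) uniform_circle"
    using assms by (intro circle_weak_conv_if_moments) auto
  with f have "(\<lambda>n::nat. \<integral>\<xi>. f \<xi> \<partial>M) \<longlonglongrightarrow> (\<integral>\<xi>. f \<xi> \<partial>uniform_circle)"
    unfolding circle_weak_conv_def by blast
  then show "(\<integral>\<xi>. f \<xi> \<partial>M) = (\<integral>\<xi>. f \<xi> \<partial>uniform_circle)" by (simp add: LIMSEQ_const_iff)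
qed

subsection \<open>Free operators\<close>

abbreviation opow :: "nat \<Rightarrow> 'h::complex_hilbert_space oper \<Rightarrow> 'h oper" where
  "opow k T \<equiv> oprod (replicate k T)"

lemma opow_add: "opow (j + k) T = opow j T o\<^sub>L opow k T"
  by (simp add: replicate_add oprod_append)

lemma opow_commute: "T o\<^sub>L opow k T = opow k T o\<^sub>L T"
  using opow_add[of 1 k T] opow_add[of k 1 T] by simp

lemmas oper_algebra_simps = blinfun.minus_left blinfun.add_left blinfun.add_right blinfun.diff_left blinfun.diff_right
  scaleC_add_right scaleC_add_left scaleC_diff_right scaleC_diff_left scaleC_minus_left scaleC_scaleC

lemma norm_oscale_le: "norm (oscale c T) \<le> cmod c * norm T"
  by (rule norm_blinfun_bound)
     (auto simp: norm_scaleC mult.assoc intro!: mult_left_mono norm_blinfun)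

lemma norm_opow_le: "norm T \<le> M \<Longrightarrow> M \<ge> 1 \<Longrightarrow> norm (opow k T) \<le> M ^ k"
proof (induction k)
  case 0
  then show ?case using norm_blinfun_id_le[where 'a='a] by simp
next
  case (Suc k)
  have "norm (T o\<^sub>L opow k T) \<le> norm T * norm (opow k T)" by (rule norm_blinfun_compose)
  also have "\<dots> \<le> M * M ^ k" using Suc by (intro mult_mono) auto
  finally show ?case by simp
qed

text \<open>Telescoping: S^(k+1) - T^(k+1) = S (S^k - T^k) + (S - T) T^k. The exponent
  \<open>k\<close> where \<open>k - 1\<close> would do is harmless because
  \<open>M \<ge> 1\<close>.\<close>

lemma norm_opow_diff_le:
  assumes "norm S \<le> M" "norm T \<le> M" "M \<ge> 1"
  shows "norm (opow k S - opow k T) \<le> real k * M ^ k * norm (S - T)"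
proof (induction k)
  case (Suc k)
  have "opow (Suc k) S - opow (Suc k) T = (S o\<^sub>L (opow k S - opow k T)) + ((S - T) o\<^sub>L opow k T)"
    by (auto intro!: blinfun_eqI simp: oper_algebra_simps)
  also have "norm \<dots> \<le> norm S * norm (opow k S - opow k T) + norm (S - T) * norm (opow k T)"
    by (intro norm_triangle_le add_mono norm_blinfun_compose)
  also have "\<dots> \<le> M * (real k * M ^ k * norm (S - T)) + norm (S - T) * M ^ k"
    by (intro add_mono mult_mono norm_opow_le Suc assms) (use assms in auto)
  also have "\<dots> \<le> M * (real k * M ^ k * norm (S - T)) + norm (S - T) * M ^ Suc k"
    using assms(3) by (intro add_left_mono mult_left_mono power_increasing) auto
  finally show ?case by (simp add: algebra_simps)
qed simp

context cstar_operator_algebra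
begin

lemma scale_apply: "A \<in> \<A> \<Longrightarrow> blinfun_apply A (c *\<^sub>C x) = c *\<^sub>C blinfun_apply A x"
  using clinear by (simp add: clinear_oper_def)

lemma zero_mem: "0 \<in> \<A>"
proof -
  have "oscale 0 id_blinfun = (0 :: 'h oper)" by (auto intro!: blinfun_eqI)
  then show ?thesis using oscale_mem[OF id_mem, of 0] by simp
qed

lemma diff_mem: "A \<in> \<A> \<Longrightarrow> B \<in> \<A> \<Longrightarrow> A - B \<in> \<A>"
proof -
  assume AB: "A \<in> \<A>" "B \<in> \<A>"
  have "A - B = A + oscale (-1) B"
    by (auto intro!: blinfun_eqI simp: oper_algebra_simps)
  then show ?thesis using add_mem[OF AB(1) oscale_mem[OF AB(2)]] by (simp only:)
qed

lemma oprod_mem: "set Ts \<subseteq> \<A> \<Longrightarrow> oprod Ts \<in> \<A>"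
  by (induction Ts) (auto intro: id_mem comp_mem)

lemma opow_mem: "T \<in> \<A> \<Longrightarrow> opow k T \<in> \<A>"
  by (rule oprod_mem) auto

lemma generated_algebra_subset:
  assumes "A \<in> \<A>" shows "generated_algebra A \<subseteq> \<A>"
proof -
  have "T \<in> \<A>" if "T \<in> star_polynomials A" for T
    using that by induction (auto intro: id_mem add_mem oscale_mem comp_mem adj_mem assms)
  then show ?thesis
    unfolding generated_algebra_def by (intro closure_minimal norm_closed) auto
qed

end

lemma opow_minus_const_generated:
  "opow k A - oscale c id_blinfun \<in> generated_algebra A"
proof -
  have "opow k A \<in> star_polynomials A"
    by (induction k) (auto intro: star_polynomials.intros)
  moreover have "opow k A - oscale c id_blinfun = opow k A + oscale (- c) id_blinfun"
    by (auto intro!: blinfun_eqI simp: oper_algebra_simps)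
  ultimately show ?thesis
    unfolding generated_algebra_def
    by (intro subsetD[OF closure_subset]) (simp only: star_polynomials.intros)
qed

context nc_prob_space
begin

lemma E_zero: "E 0 = 0"
  using E_add[OF zero_mem zero_mem] by simp

lemma E_diff: "A \<in> \<A> \<Longrightarrow> B \<in> \<A> \<Longrightarrow> E (A - B) = E A - E B"
  using E_add[of "A - B" B] by (simp add: diff_mem)

lemma E_bounded: obtains C where "\<And>T. T \<in> \<A> \<Longrightarrow> cmod (E T) \<le> C * norm T"
proof -
  obtain d where d: "d > 0" "\<And>T. T \<in> \<A> \<Longrightarrow> norm T < d \<Longrightarrow> cmod (E T) < 1"
    using E_continuous[unfolded continuous_on_iff, rule_format, OF zero_mem, of 1]
    by (auto simp: E_zero)
  have "cmod (E T) \<le> (2 / d) * norm T" if T: "T \<in> \<A>" for T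
  proof (cases "T = 0")
    case False
    \<comment> \<open>Rescales \<open>T\<close> to norm \<open>d / 2\<close>, inside the ball
      supplied by continuity at 0.\<close>
    define c where "c = d / (2 * norm T)"
    have c: "c > 0" using False d by (simp add: c_def)
    have "norm (oscale c T) \<le> c * norm T" using norm_oscale_le[of c T] c by simp
    also have "\<dots> < d" using False d by (simp add: c_def)
    finally have "cmod (E (oscale c T)) < 1" using d T oscale_mem by blast
    then have "c * cmod (E T) < 1" using E_oscale[OF T, of c] c by (simp add: norm_mult)
    then show ?thesis using c False d by (simp add: c_def field_simps)
  qed (simp add: E_zero)
  then show ?thesis by (rule that)
qed

end

locale free_operators = nc_prob_space \<A> E
  for \<A> :: "'h::{complex_hilbert_space, second_countable_topology} oper set" and E +
  fixes X :: "nat \<Rightarrow> 'h oper"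
  assumes X_mem: "1 \<le> i \<Longrightarrow> X i \<in> \<A>"
    and free: "free_sequence E X"
begin

text \<open>Lists of pairs (index, letter) replace the numbered families of
  \<open>free_family\<close>, so that multiplying words is appending lists.\<close>

definition centred_word :: "(nat \<times> 'h oper) list \<Rightarrow> bool" where
  "centred_word ws \<longleftrightarrow> ws \<noteq> [] \<and> successively (\<lambda>v w. fst v \<noteq> fst w) ws \<and>
    (\<forall>w\<in>set ws. 1 \<le> fst w \<and> snd w \<in> generated_algebra (X (fst w)) \<and> E (snd w) = 0)"

lemma E_centred_word:
  assumes "centred_word ws"
  shows "E (oprod (map snd ws)) = 0"
proof -
  \<comment> \<open>\<open>free_family\<close> numbers letters from 1 and lists from 0, hence
    \<open>s - 1\<close>. The finite subfamily used is the set of indices occurring in the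
    word.\<close>
  let ?m = "length ws" and ?i = "\<lambda>s. fst (ws ! (s - 1))" and ?B = "\<lambda>s. snd (ws ! (s - 1))"
  have "finite (fst ` set ws)" "fst ` set ws \<subseteq> {1..}"
    using assms by (auto simp: centred_word_def)
  then have "free_family E (fst ` set ws) X"
    using free unfolding free_sequence_def by blast
  moreover have "1 \<le> ?m" using assms by (cases ws) (auto simp: centred_word_def)
  moreover have "\<forall>s\<in>{1..?m}. ?i s \<in> fst ` set ws \<and> ?B s \<in> generated_algebra (X (?i s)) \<and> E (?B s) = 0"
    using assms by (auto simp: centred_word_def)
  moreover have "\<forall>s\<in>{1..<?m}. ?i (s + 1) \<noteq> ?i s"
  proof
    fix s assume "s \<in> {1..<?m}"
    then show "?i (s + 1) \<noteq> ?i s"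
      using assms by (cases s) (auto simp: centred_word_def successively_conv_nth)
  qed
  ultimately have "E (oprod (map ?B [1..<?m + 1])) = 0"
    unfolding free_family_def by (elim allE[of _ ?m] allE[of _ ?i] allE[of _ ?B] impE) assumption+
  moreover have "map ?B [1..<?m + 1] = map snd ws"
    by (rule nth_equalityI) (auto simp del: upt_Suc)
  ultimately show ?thesis by simp
qed

text \<open>Linear combinations of alternating centred words whose first letter has its index in \<open>I\<close> and whose
  last letter has its index in \<open>J\<close>; the indices in between are unconstrained.\<close>

inductive alternating :: "nat set \<Rightarrow> nat set \<Rightarrow> 'h oper \<Rightarrow> bool" for I J where
  alternating_zero: "alternating I J 0"
| alternating_word: "centred_word ws \<Longrightarrow> fst (hd ws) \<in> I \<Longrightarrow> fst (last ws) \<in> J \<Longrightarrow>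
    alternating I J (oprod (map snd ws))"
| alternating_add: "alternating I J S \<Longrightarrow> alternating I J T \<Longrightarrow> alternating I J (S + T)"
| alternating_scale: "alternating I J S \<Longrightarrow> alternating I J (oscale c S)"

lemma centred_word_mem: "centred_word ws \<Longrightarrow> oprod (map snd ws) \<in> \<A>"
  by (rule oprod_mem) (use generated_algebra_subset X_mem in \<open>auto simp: centred_word_def\<close>)

lemma alternating_mem: "alternating I J T \<Longrightarrow> T \<in> \<A>"
  by (induction rule: alternating.induct)
     (auto intro: zero_mem add_mem oscale_mem centred_word_mem)

lemma E_alternating: "alternating I J T \<Longrightarrow> E T = 0"
  by (induction rule: alternating.induct)
     (auto simp: E_zero E_add E_oscale E_centred_word alternating_mem)

lemma alternating_mono: "alternating I J T \<Longrightarrow> I \<subseteq> I' \<Longrightarrow> J \<subseteq> J' \<Longrightarrow> alternating I' J' T"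
  by (induction rule: alternating.induct) (auto intro: alternating.intros)

lemma alternating_letter:
  assumes "1 \<le> i" "B \<in> generated_algebra (X i)" "E B = 0"
  shows "alternating {i} {i} B"
  using alternating_word[of "[(i, B)]" "{i}" "{i}"] assms by (simp add: centred_word_def)

text \<open>Disjointness of \<open>J\<close> and \<open>K\<close> makes the two letters at the
  junction differ in index, so concatenated words still alternate; bilinearity extends this to
  spans.\<close>

lemma alternating_compose:
  assumes S: "alternating I J S" and T: "alternating K L T" and JK: "J \<inter> K = {}"
  shows "alternating I L (S o\<^sub>L T)"
  using S
proof (induction rule: alternating.induct)
  case alternating_zero
  then show ?case by (simp add: alternating.alternating_zero)
next
  case (alternating_word vs)
  note vs = alternating_word
  have mem: "oprod (map snd vs) \<in> \<A>" using vs by (simp add: centred_word_mem)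
  show ?case using T
  proof (induction rule: alternating.induct)
    case alternating_zero
    then show ?case by (simp add: alternating.alternating_zero)
  next
    case (alternating_word ws)
    have "vs \<noteq> []" "ws \<noteq> []" using vs alternating_word by (auto simp: centred_word_def)
    moreover have "centred_word (vs @ ws)"
      using vs alternating_word JK by (auto simp: centred_word_def successively_append_iff)
    ultimately show ?case
      using alternating.alternating_word[of "vs @ ws" I L] vs alternating_word
      by (simp add: oprod_append)
  next
    case (alternating_add T T')
    have "oprod (map snd vs) o\<^sub>L (T + T') = (oprod (map snd vs) o\<^sub>L T) + (oprod (map snd vs) o\<^sub>L T')"
      by (auto intro!: blinfun_eqI simp: oper_algebra_simps)
    with alternating_add show ?case by (simp add: alternating.alternating_add)
  next
    case (alternating_scale T c)
    have "oprod (map snd vs) o\<^sub>L oscale c T = oscale c (oprod (map snd vs) o\<^sub>L T)"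
      by (auto intro!: blinfun_eqI simp: scale_apply[OF mem])
    with alternating_scale show ?case by (simp add: alternating.alternating_scale)
  qed
next
  case (alternating_add S S')
  have "(S + S') o\<^sub>L T = (S o\<^sub>L T) + (S' o\<^sub>L T)"
    by (auto intro!: blinfun_eqI simp: oper_algebra_simps)
  with alternating_add show ?case by (simp add: alternating.alternating_add)
next
  case (alternating_scale S c)
  have "oscale c S o\<^sub>L T = oscale c (S o\<^sub>L T)" by (auto intro!: blinfun_eqI)
  with alternating_scale show ?case by (simp add: alternating.alternating_scale)
qed

text \<open>Says that \<open>T\<close> is the scalar \<open>c\<close> plus a span of centred words
  with both ends in \<open>I\<close>. This carries the freeness of composite operators, without
  describing the algebras they generate.\<close>

abbreviation centred_at :: "nat set \<Rightarrow> complex \<Rightarrow> 'h oper \<Rightarrow> bool" where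
  "centred_at I c T \<equiv> alternating I I (T - oscale c id_blinfun)"

lemma centred_at_mem: "centred_at I c T \<Longrightarrow> T \<in> \<A>"
  using add_mem[OF alternating_mem oscale_mem[OF id_mem]] by (metis diff_add_cancel)

lemma E_centred_at:
  assumes "centred_at I c T" shows "E T = c"
  using E_alternating[OF assms] centred_at_mem[OF assms]
  by (simp add: E_diff E_oscale E_id id_mem oscale_mem)

text \<open>Rests on A B - a b = A' B' + b A' + a B' with A' = A - a and B' = B - b; each term is
  alternating.\<close>

lemma centred_at_compose:
  assumes A: "centred_at I a A" and B: "centred_at J b B" and IJ: "I \<inter> J = {}"
  shows "centred_at (I \<union> J) (a * b) (A o\<^sub>L B)"
proof -
  let ?A = "A - oscale a id_blinfun" and ?B = "B - oscale b id_blinfun"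
  have "(A o\<^sub>L B) - oscale (a * b) id_blinfun = (?A o\<^sub>L ?B) + oscale b ?A + oscale a ?B"
    using scale_apply[OF centred_at_mem[OF A]]
    by (auto intro!: blinfun_eqI simp: oper_algebra_simps mult.commute)
  moreover have "alternating (I \<union> J) (I \<union> J) (?A o\<^sub>L ?B)"
    by (rule alternating_mono[OF alternating_compose[OF A B IJ]]) auto
  moreover have "alternating (I \<union> J) (I \<union> J) ?A" "alternating (I \<union> J) (I \<union> J) ?B"
    by (rule alternating_mono[OF A]; blast) (rule alternating_mono[OF B]; blast)
  ultimately show ?thesis by (simp add: alternating_add alternating_scale)
qed

lemma centred_at_opow:
  assumes "1 \<le> i" shows "centred_at {i} (E (opow k (X i))) (opow k (X i))"
  using assms
  by (intro alternating_letter opow_minus_const_generated)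
     (simp_all add: E_diff E_oscale E_id opow_mem X_mem id_mem oscale_mem)

lemma centred_at_oprod:
  assumes "1 \<le> l" "l \<le> n"
  shows "centred_at {l..<n} (\<Prod>k = l..<n. E (X k)) (oprod (map X [l..<n]))"
  using assms(2)
proof (induction n rule: dec_induct)
  case base
  have "id_blinfun - oscale 1 id_blinfun = (0 :: 'h oper)" by (auto intro!: blinfun_eqI simp: blinfun.diff_left)
  then show ?case by (simp add: alternating_zero)
next
  case (step n)
  have "centred_at {n} (E (X n)) (X n)"
    using centred_at_opow[of n 1] assms step by simp
  from centred_at_compose[OF step.IH this]
  show ?case using step by (simp add: oprod_append atLeastLessThanSuc Un_commute mult.commute)
qed

lemma E_oprod:
  assumes "1 \<le> l" "l \<le> n"
  shows "E (oprod (map X [l..<n])) = (\<Prod>k = l..<n. E (X k))"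
  by (rule E_centred_at[OF centred_at_oprod[OF assms]])

text \<open>\<open>C\<close> depends only on \<open>k\<close> and the bound of \<open>E\<close>.
  This uniformity matters because both the factors and \<open>e\<close> vary when the estimate is
  applied to long products.\<close>

lemma E_opow_compose_small:
  obtains C where "\<And>A B a b I J e. \<lbrakk>centred_at I a A; centred_at J b B; I \<inter> J = {};
      norm A \<le> 1; norm B \<le> 1; cmod a \<le> e; cmod b \<le> e; e \<le> 1; 1 \<le> k\<rbrakk>
    \<Longrightarrow> cmod (E (opow k (A o\<^sub>L B))) \<le> C * e"
proof -
  obtain K where K: "\<And>T. T \<in> \<A> \<Longrightarrow> cmod (E T) \<le> K * norm T" using E_bounded by blast
  show ?thesis
  \<comment> \<open>The 4 bounds both A B and A' B', whose factors have norm at most 2; the 3 is 1 +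
    2, from A B - A' B' = b A + a B'.\<close>
  proof (rule that[of "\<bar>K\<bar> * (real k * 4 ^ k * 3)"])
    fix A B :: "'h oper" and a b I J and e :: real
    assume A: "centred_at I a A" and B: "centred_at J b B" and IJ: "I \<inter> J = {}"
      and nA: "norm A \<le> 1" and nB: "norm B \<le> 1" and a: "cmod a \<le> e" and b: "cmod b \<le> e"
      and e: "e \<le> 1" and k: "1 \<le> k"
    have e0: "0 \<le> e" using a norm_ge_zero by (rule order_trans[rotated])
    define A' B' where "A' = A - oscale a id_blinfun" and "B' = B - oscale b id_blinfun"
    have alt: "alternating I J (opow (Suc j) (A' o\<^sub>L B'))" for j
    proof (induction j)
      case 0
      then show ?case using alternating_compose[OF A B IJ] by (simp add: A'_def B'_def)
    next
      case (Suc j)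
      have "alternating I J (A' o\<^sub>L B')"
        using alternating_compose[OF A B IJ] by (simp add: A'_def B'_def)
      from alternating_compose[OF this Suc] IJ show ?case by (simp add: Int_commute)
    qed
    have "alternating I J (opow k (A' o\<^sub>L B'))" using alt[of "k - 1"] k by simp
    then have E0: "E (opow k (A' o\<^sub>L B')) = 0" and mem': "opow k (A' o\<^sub>L B') \<in> \<A>"
      by (rule E_alternating, rule alternating_mem)
    have mem: "opow k (A o\<^sub>L B) \<in> \<A>"
      using A B by (intro opow_mem comp_mem) (auto intro: centred_at_mem)
    have nid: "norm (oscale c id_blinfun :: 'h oper) \<le> cmod c" for c
      using order_trans[OF norm_oscale_le[of c id_blinfun] mult_left_mono[OF norm_blinfun_id_le]] by simp
    have nA': "norm A' \<le> 2" and nB': "norm B' \<le> 2"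
      unfolding A'_def B'_def
      using norm_triangle_ineq4[of A "oscale a id_blinfun"] norm_triangle_ineq4[of B "oscale b id_blinfun"]
        nid[of a] nid[of b] nA nB a b e by linarith+
    have n1: "norm (A' o\<^sub>L B') \<le> 4"
      using order_trans[OF norm_blinfun_compose mult_mono[OF nA' nB']] by simp
    have n2: "norm (A o\<^sub>L B) \<le> 4"
      using order_trans[OF norm_blinfun_compose mult_mono[OF nA nB]] by simp
    have "(A o\<^sub>L B) - (A' o\<^sub>L B') = oscale b A + oscale a B' "
      using scale_apply[OF centred_at_mem[OF A]]
      by (auto intro!: blinfun_eqI simp: A'_def B'_def oper_algebra_simps)
    also have "norm \<dots> \<le> norm (oscale b A) + norm (oscale a B')" by (rule norm_triangle_ineq)
    also have "\<dots> \<le> cmod b * norm A + cmod a * norm B'" by (intro add_mono norm_oscale_le)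
    also have "\<dots> \<le> e * 1 + e * 2"
      using a b nA nB' e0 by (intro add_mono mult_mono) auto
    finally have d: "norm ((A o\<^sub>L B) - (A' o\<^sub>L B')) \<le> 3 * e" by simp
    have "E (opow k (A o\<^sub>L B)) = E (opow k (A o\<^sub>L B) - opow k (A' o\<^sub>L B'))"
      by (simp add: E_diff mem mem' E0)
    also have "cmod \<dots> \<le> K * norm (opow k (A o\<^sub>L B) - opow k (A' o\<^sub>L B'))"
      by (intro K diff_mem mem mem')
    also have "\<dots> \<le> \<bar>K\<bar> * norm (opow k (A o\<^sub>L B) - opow k (A' o\<^sub>L B'))"
      by (intro mult_right_mono) auto
    also have "\<dots> \<le> \<bar>K\<bar> * (real k * 4 ^ k * norm ((A o\<^sub>L B) - (A' o\<^sub>L B')))"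
      by (intro mult_left_mono norm_opow_diff_le n1 n2) auto
    also have "\<dots> \<le> \<bar>K\<bar> * (real k * 4 ^ k * (3 * e))"
      by (intro mult_left_mono d) auto
    finally show "cmod (E (opow k (A o\<^sub>L B))) \<le> \<bar>K\<bar> * (real k * 4 ^ k * 3) * e"
      by (simp add: mult_ac)
  qed
qed

text \<open>With D = B A the power is A (X D)^(k-1) X B. Writing D = c + D', the scalar merges
  neighbouring X into a power, while D' separates powers of X below \<open>k\<close>, which are
  centred. Hence the middle is c^(k-1) X^k up to words from \<open>i\<close> to \<open>i\<close>,
  and these have mean 0 even between A and B.\<close>

lemma E_opow_sandwich:
  assumes A: "centred_at L a A" and B: "centred_at R b B" and LR: "L \<inter> R = {}"
    and i: "1 \<le> i" "i \<notin> L" "i \<notin> R"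
    and k: "1 \<le> k" and moments: "\<And>j. 1 \<le> j \<Longrightarrow> j < k \<Longrightarrow> E (opow j (X i)) = 0"
  shows "E (opow k (A o\<^sub>L X i o\<^sub>L B)) = (a * b) ^ k * E (opow k (X i))"
proof -
  define c where "c = a * b"
  define D where "D = B o\<^sub>L A"
  define D' where "D' = D - oscale c id_blinfun"
  define q where "q j = opow j (X i o\<^sub>L D) o\<^sub>L X i" for j
  note memA = centred_at_mem[OF A] and memB = centred_at_mem[OF B] and memX = X_mem[OF i(1)]
  have memD: "D \<in> \<A>" unfolding D_def by (intro comp_mem memA memB)
  have memq: "q j \<in> \<A>" for j unfolding q_def by (intro comp_mem opow_mem memX memD)
  note scaled = scale_apply[OF memA] scale_apply[OF memB] scale_apply[OF memX] scale_apply[OF memD]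
    scale_apply[OF opow_mem[OF memX]]
  have "centred_at (R \<union> L) (b * a) (B o\<^sub>L A)"
    by (rule centred_at_compose[OF B A]) (use LR in auto)
  then have D': "alternating (L \<union> R) (L \<union> R) D'"
    by (simp add: D'_def D_def c_def Un_commute mult.commute)
  have power: "alternating {i} {i} (opow j (X i))" if "1 \<le> j" "j < k" for j
  proof -
    have "opow j (X i) = opow j (X i) - oscale 0 id_blinfun"
      by (auto intro!: blinfun_eqI simp: blinfun.diff_left)
    then show ?thesis using centred_at_opow[OF i(1), of j] moments[OF that] by simp
  qed
  \<comment> \<open>The left factor \<open>opow s (X i)\<close> generalises the induction: the
    scalar part of D moves one X to the left. The condition \<open>s + j < k\<close> keeps every
    separate power below order \<open>k\<close>, hence centred.\<close>
  have q: "alternating {i} {i} (opow s (X i) o\<^sub>L (q j - oscale (c ^ j) (opow (Suc j) (X i))))"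
    if "s + j < k" for s j
    using that
  proof (induction j arbitrary: s)
    case 0
    have "q 0 - oscale (c ^ 0) (opow (Suc 0) (X i)) = 0"
      by (auto intro!: blinfun_eqI simp: q_def blinfun.diff_left)
    then show ?case by (simp add: alternating_zero)
  next
    case (Suc j)
    define Z where "Z = q j - oscale (c ^ j) (opow (Suc j) (X i))"
    have Z: "alternating {i} {i} Z" using Suc.IH[of 0] Suc.prems by (simp add: Z_def)
    have memZ: "Z \<in> \<A>" using Z by (rule alternating_mem)
    have "X i o\<^sub>L opow s (X i) = opow s (X i) o\<^sub>L X i" by (rule opow_commute)
    then have comm: "blinfun_apply (X i) (blinfun_apply (opow s (X i)) u) =
        blinfun_apply (opow s (X i)) (blinfun_apply (X i) u)" for u
      by (metis blinfun_apply_blinfun_compose)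
    have qS: "q (Suc j) = X i o\<^sub>L D o\<^sub>L q j" by (simp add: q_def blinfun_compose_assoc)
    have "opow s (X i) o\<^sub>L (q (Suc j) - oscale (c ^ Suc j) (opow (Suc (Suc j)) (X i))) =
        oscale c (opow (Suc s) (X i) o\<^sub>L Z) + (opow (Suc s) (X i) o\<^sub>L (D' o\<^sub>L q j))"
      unfolding qS Z_def D'_def
      by (auto intro!: blinfun_eqI simp: oper_algebra_simps scaled comm)
    moreover have "alternating {i} {i} (opow (Suc s) (X i) o\<^sub>L Z)"
      unfolding Z_def by (rule Suc.IH) (use Suc.prems in simp)
    moreover have "alternating {i} {i} (opow (Suc s) (X i) o\<^sub>L (D' o\<^sub>L q j))"
    proof (rule alternating_compose)
      show "alternating {i} {i} (opow (Suc s) (X i))" by (rule power) (use Suc.prems in auto)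
      have "alternating {i} {i} (opow (Suc j) (X i))" by (rule power) (use Suc.prems in auto)
      then have "alternating {i} {i} (Z + oscale (c ^ j) (opow (Suc j) (X i)))"
        using Z by (intro alternating_add alternating_scale)
      then have "alternating {i} {i} (q j)" by (simp add: Z_def)
      then show "alternating (L \<union> R) {i} (D' o\<^sub>L q j)"
        using D' i by (intro alternating_compose) auto
      show "{i} \<inter> (L \<union> R) = {}" using i by auto
    qed
    ultimately show ?case by (simp add: alternating_add alternating_scale)
  qed
  obtain j where j: "k = Suc j" using k by (cases k) auto
  have pow: "opow (Suc j) (A o\<^sub>L X i o\<^sub>L B) = A o\<^sub>L q j o\<^sub>L B" for j
    by (induction j) (simp_all add: q_def D_def blinfun_compose_assoc)
  define m where "m = E (opow k (X i))"
  \<comment> \<open>X^k is the first power that need not be centred; removing its mean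
    \<open>m\<close> leaves \<open>q j\<close> as the scalar \<open>c ^ j * m\<close> plus a span of
    words from \<open>i\<close> to \<open>i\<close>.\<close>
  define V where "V = oscale (c ^ j) (opow k (X i) - oscale m id_blinfun) +
    (q j - oscale (c ^ j) (opow (Suc j) (X i)))"
  have V: "alternating {i} {i} V"
    unfolding V_def m_def
    using q[of 0 j] j centred_at_opow[OF i(1), of k]
    by (intro alternating_add alternating_scale) (auto simp del: replicate_Suc)
  have "q j = oscale (c ^ j * m) id_blinfun + V"
    unfolding V_def j by (auto intro!: blinfun_eqI simp: oper_algebra_simps)
  then have "A o\<^sub>L q j o\<^sub>L B = oscale (c ^ j * m) (A o\<^sub>L B) + (A o\<^sub>L V o\<^sub>L B)"
    by (auto intro!: blinfun_eqI simp: oper_algebra_simps scaled)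
  moreover have "E (A o\<^sub>L V o\<^sub>L B) = 0"
  proof -
    let ?A = "A - oscale a id_blinfun" and ?B = "B - oscale b id_blinfun"
    have 1: "alternating L {i} (?A o\<^sub>L V)" by (rule alternating_compose[OF A V]) (use i in auto)
    have 2: "alternating L R (?A o\<^sub>L V o\<^sub>L ?B)" by (rule alternating_compose[OF 1 B]) (use i in auto)
    have 3: "alternating {i} R (V o\<^sub>L ?B)" by (rule alternating_compose[OF V B]) (use i in auto)
    \<comment> \<open>Expansion of both outer factors into mean plus centred part; since
      \<open>i\<close> lies in neither \<open>L\<close> nor \<open>R\<close>, all four terms are
      alternating.\<close>
    have "A o\<^sub>L V o\<^sub>L B = (?A o\<^sub>L V o\<^sub>L ?B) + oscale b (?A o\<^sub>L V) + oscale a (V o\<^sub>L ?B) + oscale (a * b) V"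
      using scale_apply[OF alternating_mem[OF V]]
      by (auto intro!: blinfun_eqI simp: oper_algebra_simps scaled mult_ac)
    then show ?thesis
      using 1 2 3 V by (simp add: E_add E_oscale E_alternating alternating_mem add_mem oscale_mem)
  qed
  moreover have "E (A o\<^sub>L B) = c"
    using E_centred_at[OF centred_at_compose[OF A B LR]] by (simp add: c_def)
  ultimately have "E (A o\<^sub>L q j o\<^sub>L B) = c ^ j * m * c"
    using memA memB alternating_mem[OF V] by (simp add: E_add E_oscale comp_mem oscale_mem)
  then show ?thesis using pow[of j] by (simp add: j m_def c_def mult_ac del: replicate_Suc)
qed

end

subsection \<open>Products of free unitaries\<close>

locale free_unitaries = free_operators +
  assumes X_unitary: "1 \<le> i \<Longrightarrow> unitary_oper (X i)"
begin

lemma norm_oprod_le: "1 \<le> l \<Longrightarrow> norm (oprod (map X [l..<n])) \<le> 1"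
  by (intro norm_unitary_oper_le unitary_oper_oprod) (auto intro: X_unitary)

lemma oprod_split:
  assumes "1 \<le> l" "l \<le> n + 1"
  shows "oprod (map X [1..<n + 1]) = oprod (map X [1..<l]) o\<^sub>L oprod (map X [l..<n + 1])"
  using upt_add_eq_append[of 1 l "n + 1 - l"] assms by (simp add: oprod_append del: upt_Suc)

text \<open>Once both factors of \<open>\<Pi>\<^sub>n = (X\<^sub>1 \<cdots> X\<^sub>m) (X\<^sub>m\<^sub>+\<^sub>1 \<cdots> X\<^sub>n)\<close> have small mean, every power of \<open>\<Pi>\<^sub>n\<close> is close to
  an alternating product of centred factors.\<close>

lemma E_opow_oprod_tendsto_0:
  assumes split: "\<And>e. e > 0 \<Longrightarrow> \<exists>m. cmod (\<Prod>k = 1..m. E (X k)) \<le> e \<and>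
      (\<lambda>n. \<Prod>k = m + 1..n. E (X k)) \<longlonglongrightarrow> 0"
    and k: "k \<ge> 1"
  shows "(\<lambda>n. E (opow k (oprod (map X [1..<n + 1])))) \<longlonglongrightarrow> 0"
proof (rule E_opow_compose_small[where k = k])
  fix C
  assume C: "\<And>A B a b I J e. \<lbrakk>centred_at I a A; centred_at J b B; I \<inter> J = {};
      norm A \<le> 1; norm B \<le> 1; cmod a \<le> e; cmod b \<le> e; e \<le> 1; 1 \<le> k\<rbrakk>
    \<Longrightarrow> cmod (E (opow k (A o\<^sub>L B))) \<le> C * e"
  show ?thesis
  proof (rule tendstoI)
    fix r :: real assume r: "r > 0"
    \<comment> \<open>\<open>C\<close> may be 0 or negative, hence the denominator; the minimum with
      1 meets the condition \<open>e \<le> 1\<close> of the estimate.\<close>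
    define e where "e = min 1 (r / (2 * (\<bar>C\<bar> + 1)))"
    have e: "e > 0" "e \<le> 1" using r by (auto simp: e_def)
    have "C * e \<le> (\<bar>C\<bar> + 1) * e" using e by (intro mult_right_mono) auto
    also have "\<dots> \<le> (\<bar>C\<bar> + 1) * (r / (2 * (\<bar>C\<bar> + 1)))" by (intro mult_left_mono) (auto simp: e_def)
    also have "\<dots> = r / 2" by (simp add: field_simps add_nonneg_eq_0_iff)
    also have "\<dots> < r" using r by simp
    finally have Ce: "C * e < r" .
    obtain m where m: "cmod (\<Prod>k = 1..m. E (X k)) \<le> e" "(\<lambda>n. \<Prod>k = m + 1..n. E (X k)) \<longlonglongrightarrow> 0"
      using split[OF e(1)] by blast
    have "\<forall>\<^sub>F n in sequentially. cmod (\<Prod>k = m + 1..n. E (X k)) < e"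
      using tendstoD[OF m(2) e(1)] by simp
    then show "\<forall>\<^sub>F n in sequentially. dist (E (opow k (oprod (map X [1..<n + 1])))) 0 < r"
      using eventually_ge_at_top[of m]
    proof eventually_elim
      case (elim n)
      have "cmod (E (opow k (oprod (map X [1..<m + 1]) o\<^sub>L oprod (map X [m + 1..<n + 1])))) \<le> C * e"
      proof (rule C)
        show "centred_at {1..<m + 1} (\<Prod>k = 1..<m + 1. E (X k)) (oprod (map X [1..<m + 1]))"
          by (rule centred_at_oprod) auto
        show "centred_at {m + 1..<n + 1} (\<Prod>k = m + 1..<n + 1. E (X k)) (oprod (map X [m + 1..<n + 1]))"
          by (rule centred_at_oprod) (use elim in auto)
        show "cmod (\<Prod>k = 1..<m + 1. E (X k)) \<le> e" "cmod (\<Prod>k = m + 1..<n + 1. E (X k)) \<le> e"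
          using m(1) elim by (simp_all add: atLeastLessThanSuc_atLeastAtMost)
      qed (use e k norm_oprod_le in \<open>auto simp del: upt_Suc\<close>)
      then show ?case using Ce oprod_split[of "m + 1" n] elim by (simp del: upt_Suc)
    qed
  qed
qed

lemma E_opow_oprod_factor:
  assumes i: "1 \<le> i" "i \<le> n" and k: "1 \<le> k" and moments: "\<And>j. 1 \<le> j \<Longrightarrow> j < k \<Longrightarrow> E (opow j (X i)) = 0"
  shows "E (opow k (oprod (map X [1..<n + 1]))) =
    ((\<Prod>k = 1..<i. E (X k)) * (\<Prod>k = i + 1..n. E (X k))) ^ k * E (opow k (X i))"
proof -
  have "[i..<n + 1] = i # [i + 1..<n + 1]" using i by (simp add: upt_conv_Cons del: upt_Suc)
  then have "oprod (map X [1..<n + 1]) = oprod (map X [1..<i]) o\<^sub>L X i o\<^sub>L oprod (map X [i + 1..<n + 1])"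
    using oprod_split[of i n] i by (simp add: blinfun_compose_assoc del: upt_Suc)
  moreover have "E (opow k (oprod (map X [1..<i]) o\<^sub>L X i o\<^sub>L oprod (map X [i + 1..<n + 1]))) =
    ((\<Prod>k = 1..<i. E (X k)) * (\<Prod>k = i + 1..<n + 1. E (X k))) ^ k * E (opow k (X i))"
    by (rule E_opow_sandwich[OF centred_at_oprod centred_at_oprod]) (use i k moments in auto)
  ultimately show ?thesis by (simp add: atLeastLessThanSuc_atLeastAtMost)
qed

end

theorem theorem1:
  fixes \<A> :: "'h::{complex_hilbert_space, second_countable_topology} oper set"
    and E :: "'h oper \<Rightarrow> complex"
    and X :: "nat \<Rightarrow> 'h oper"
    and \<mu> \<mu>\<Pi> :: "nat \<Rightarrow> complex measure"
  assumes "nc_prob_space \<A> E"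
    and "\<And>i. 1 \<le> i \<Longrightarrow> X i \<in> \<A>"
    and "\<And>i. 1 \<le> i \<Longrightarrow> unitary_oper (X i)"
    and "free_sequence E X"
    and "\<And>i. 1 \<le> i \<Longrightarrow> spectral_prob_measure E (X i) (\<mu> i)"
    and "\<And>n. 1 \<le> n \<Longrightarrow> spectral_prob_measure E (oprod (map X [1..<n + 1])) (\<mu>\<Pi> n)"
  shows "circle_weak_conv \<mu>\<Pi> uniform_circle \<longleftrightarrow>
     (\<exists>i\<ge>1. \<exists>j\<ge>1. i \<noteq> j \<and> E (X i) = 0 \<and> E (X j) = 0)
   \<or> (\<exists>i\<ge>1. E (X i) = 0 \<and> (\<forall>j\<ge>1. E (X j) = 0 \<longrightarrow> j = i)
            \<and> (\<lambda>n. \<Prod>k = i + 1..n. E (X k)) \<longlonglongrightarrow> 0)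
   \<or> (\<exists>!i. 1 \<le> i \<and> \<mu> i = uniform_circle)
   \<or> ((\<forall>k\<ge>1. E (X k) \<noteq> 0) \<and> (\<lambda>n. \<Prod>k = 1..n. E (X k)) \<longlonglongrightarrow> 0)"
  (is "?weak \<longleftrightarrow> ?i \<or> ?ii \<or> ?iii \<or> ?iv")
proof -
  interpret free_unitaries \<A> E X
    using assms by (simp add: free_unitaries_def free_operators_def free_operators_axioms_def
        free_unitaries_axioms_def)
  let ?P = "\<lambda>n. oprod (map X [1..<n + 1])"
  have unitary_P: "unitary_oper (?P n)" for n
    by (rule unitary_oper_oprod) (auto intro: X_unitary)
  have moment_P: "E (opow k (?P n)) = (\<integral>\<xi>. \<xi> ^ k \<partial>\<mu>\<Pi> n)" if "1 \<le> n" for k n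
    by (rule spectral_prob_measure_moment[OF unitary_P assms(6)[OF that]])
  have moment_X: "E (opow k (X i)) = (\<integral>\<xi>. \<xi> ^ k \<partial>\<mu> i)" if "1 \<le> i" for k i
    by (rule spectral_prob_measure_moment[OF X_unitary[OF that] assms(5)[OF that]])
  have circle: "circle_prob_measure (\<mu> i)" "circle_prob_measure (\<mu>\<Pi> i)" if "1 \<le> i" for i
    using assms(5)[OF that] assms(6)[OF that] by (simp_all add: spectral_prob_measure_def)
  have "?weak \<longleftrightarrow> (\<forall>k\<ge>1. (\<lambda>n. \<integral>\<xi>. \<xi> ^ k \<partial>\<mu>\<Pi> n) \<longlonglongrightarrow> 0)"
    by (rule circle_weak_conv_iff_moments) (rule circle)
  also have "\<dots> \<longleftrightarrow> (\<forall>k\<ge>1. (\<lambda>n. E (opow k (?P n))) \<longlonglongrightarrow> 0)"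
  proof -
    have "\<forall>\<^sub>F n in sequentially. (\<integral>\<xi>. \<xi> ^ k \<partial>\<mu>\<Pi> n) = E (opow k (?P n))" for k
      using eventually_ge_at_top[of 1] by eventually_elim (simp only: moment_P)
    then have "(\<lambda>n. \<integral>\<xi>. \<xi> ^ k \<partial>\<mu>\<Pi> n) \<longlonglongrightarrow> 0 \<longleftrightarrow> (\<lambda>n. E (opow k (?P n))) \<longlonglongrightarrow> 0" for k
      by (rule tendsto_cong)
    then show ?thesis by (simp only:)
  qed
  finally have weak_iff: "?weak \<longleftrightarrow> (\<forall>k\<ge>1. (\<lambda>n. E (opow k (?P n))) \<longlonglongrightarrow> 0)" .
  have mean_0: "E (X i) = 0" if "1 \<le> i" "\<mu> i = uniform_circle" for i
    using moment_X[OF that(1), of 1] moment_uniform_circle[of 1] that(2) by simp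
  show ?thesis
  proof

    \<comment> \<open>Necessity of the four conditions\<close>
    assume ?weak
    then have lim: "(\<lambda>n. E (opow k (?P n))) \<longlonglongrightarrow> 0" if "1 \<le> k" for k
      using that weak_iff by blast
    have "E (?P n) = (\<Prod>k = 1..n. E (X k))" for n
      using E_oprod[of 1 "n + 1"] by (simp add: atLeastLessThanSuc_atLeastAtMost del: upt_Suc)
    then have lim1: "(\<lambda>n. \<Prod>k = 1..n. E (X k)) \<longlonglongrightarrow> 0"
      using lim[of 1] by (simp del: upt_Suc)
    show "?i \<or> ?ii \<or> ?iii \<or> ?iv"
    proof (cases "\<exists>i\<ge>1. E (X i) = 0")
      case False
      then show ?thesis using lim1 by blast
    next
      case True
      then obtain i where i: "1 \<le> i" "E (X i) = 0" by blast
      show ?thesis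
      proof (cases "\<forall>j\<ge>1. E (X j) = 0 \<longrightarrow> j = i")
        case False
        then show ?thesis using i by blast
      next
        case unique: True
        show ?thesis
        proof (cases "\<mu> i = uniform_circle")
          case True
          \<comment> \<open>A uniformly distributed variable has mean 0, so uniqueness is inherited
            from that of the index of mean 0.\<close>
          then have "\<exists>!i. 1 \<le> i \<and> \<mu> i = uniform_circle"
            using i unique mean_0 by blast
          then show ?thesis by blast
        next
          case False
          define moment where "moment k = E (opow k (X i))" for k
          have "\<exists>k. 1 \<le> k \<and> moment k \<noteq> 0"
            using circle_prob_measure_eq_uniform[OF circle(1)[OF i(1)]] False
            by (auto simp: moment_def moment_X[OF i(1)])
          define k where "k = (LEAST k. 1 \<le> k \<and> moment k \<noteq> 0)"
          have k: "1 \<le> k" "moment k \<noteq> 0"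
            using LeastI_ex[OF \<open>\<exists>k. 1 \<le> k \<and> moment k \<noteq> 0\<close>] by (auto simp: k_def)
          have least: "moment j = 0" if "1 \<le> j" "j < k" for j
            using that not_less_Least[of j "\<lambda>k. 1 \<le> k \<and> moment k \<noteq> 0"] by (auto simp: k_def)
          define a where "a = (\<Prod>k = 1..<i. E (X k))"
          \<comment> \<open>All indices before \<open>i\<close> have nonzero mean, so the limit must
            be forced by the factors after \<open>i\<close>.\<close>
          have "a \<noteq> 0" using unique by (auto simp: a_def)
          define b where "b n = (\<Prod>k = i + 1..n. E (X k))" for n
          have "\<forall>\<^sub>F n in sequentially. E (opow k (?P n)) = (a * b n) ^ k * moment k"
            using eventually_ge_at_top[of i]
          proof eventually_elim
            case (elim n)
            show ?case
              unfolding a_def b_def moment_def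
              by (rule E_opow_oprod_factor) (use i k least elim in \<open>auto simp: moment_def\<close>)
          qed
          then have "(\<lambda>n. (a * b n) ^ k * moment k) \<longlonglongrightarrow> 0"
            using lim[OF k(1)] by (simp only: tendsto_cong)
          then have "(\<lambda>n. (a * b n) ^ k) \<longlonglongrightarrow> 0"
            using k(2) tendsto_mult_right_iff[of "moment k" "\<lambda>n. (a * b n) ^ k" 0] by simp
          then have "(\<lambda>n. cmod (a * b n) ^ k) \<longlonglongrightarrow> 0"
            unfolding norm_power[symmetric] by (rule tendsto_norm_zero)
          \<comment> \<open>Taking the real root of the modulus removes the exponent without
            choosing a complex root.\<close>
          then have "(\<lambda>n. root k (cmod (a * b n) ^ k)) \<longlonglongrightarrow> root k 0"
            by (rule tendsto_real_root)
          then have "(\<lambda>n. a * b n) \<longlonglongrightarrow> 0"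
            using k(1) by (simp add: real_root_power_cancel tendsto_norm_zero_iff)
          then have "b \<longlonglongrightarrow> 0"
            using \<open>a \<noteq> 0\<close> tendsto_mult_left_iff[of a b 0] by simp
          then have ?ii using i unique unfolding b_def by (intro exI[of _ i] conjI)
          then show ?thesis by (intro disjI1 disjI2)
        qed
      qed
    qed
  next

    \<comment> \<open>Sufficiency of the four conditions\<close>
    assume cases: "?i \<or> ?ii \<or> ?iii \<or> ?iv"
    show ?weak
    \<comment> \<open>A uniform factor makes every moment of the product vanish as soon as
      \<open>n \<ge> i\<close>; the other conditions all provide a cut into two factors of small
      mean.\<close>
    proof (cases ?iii)
      case True
      then obtain i where i: "1 \<le> i" "\<mu> i = uniform_circle" by blast
      have zero: "E (opow k (X i)) = 0" if "1 \<le> k" for k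
        using moment_X[OF i(1)] i(2) moment_uniform_circle[OF that] by simp
      show ?weak unfolding weak_iff
      proof (intro allI impI)
        fix k :: nat assume k: "1 \<le> k"
        have "\<forall>\<^sub>F n in sequentially. E (opow k (?P n)) = 0"
          using eventually_ge_at_top[of i]
        proof eventually_elim
          case (elim n)
          then show ?case
            using E_opow_oprod_factor[OF i(1) elim k] zero k by (simp del: upt_Suc)
        qed
        then show "(\<lambda>n. E (opow k (?P n))) \<longlonglongrightarrow> 0" by (rule tendsto_eventually)
      qed
    next
      case False
      have "\<exists>m. cmod (\<Prod>k = 1..m. E (X k)) \<le> e \<and> (\<lambda>n. \<Prod>k = m + 1..n. E (X k)) \<longlonglongrightarrow> 0"
        if e: "e > 0" for e
      proof -
        have zero: "cmod (\<Prod>k = 1..m. E (X k)) \<le> e" if "1 \<le> m" "E (X m) = 0" for m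
        proof -
          have "(\<Prod>k = 1..m. E (X k)) = 0" by (rule prod_zero) (use that in auto)
          then show ?thesis using e by (simp only: norm_zero less_imp_le)
        qed
        from cases False consider
          (two) i j where "1 \<le> i" "1 \<le> j" "i \<noteq> j" "E (X i) = 0" "E (X j) = 0"
          | (one) i where "1 \<le> i" "E (X i) = 0" "(\<lambda>n. \<Prod>k = i + 1..n. E (X k)) \<longlonglongrightarrow> 0"
          | (none) "\<forall>k\<ge>1. E (X k) \<noteq> 0" "(\<lambda>n. \<Prod>k = 1..n. E (X k)) \<longlonglongrightarrow> 0"
          by (elim disjE exE conjE) blast+
        then show ?thesis
        proof cases
          case two
          \<comment> \<open>The cut is made after the smaller index, which kills the mean of the
            first factor; the larger index kills that of the second for all
            \<open>n \<ge> m\<close>.\<close>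
          define l m where "l = min i j" and "m = max i j"
          have lm: "1 \<le> l" "l < m" "E (X l) = 0" "E (X m) = 0"
            using two by (auto simp: l_def m_def min_def max_def)
          have "\<forall>\<^sub>F n in sequentially. (\<Prod>k = l + 1..n. E (X k)) = 0"
            using eventually_ge_at_top[of m]
            by eventually_elim (rule prod_zero, use lm in auto)
          then have "(\<lambda>n. \<Prod>k = l + 1..n. E (X k)) \<longlonglongrightarrow> 0" by (rule tendsto_eventually)
          then show ?thesis using zero[OF lm(1,3)] by (intro exI[of _ l] conjI)
        next
          case one
          then show ?thesis using zero[OF one(1,2)] by (intro exI[of _ i] conjI)
        next
          case none
          have "\<forall>\<^sub>F m in sequentially. cmod (\<Prod>k = 1..m. E (X k)) < e"
            using tendstoD[OF none(2) e] by simp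
          then obtain m where m: "cmod (\<Prod>k = 1..m. E (X k)) < e"
            using eventually_happens'[OF sequentially_bot] by blast
          \<comment> \<open>As \<open>p \<noteq> 0\<close>, the mean of the tail is the full product
            divided by a fixed number, so it still tends to 0.\<close>
          define p where "p = (\<Prod>k = 1..m. E (X k))"
          have p: "p \<noteq> 0" using none(1) by (auto simp: p_def)
          have "\<forall>\<^sub>F n in sequentially. (\<Prod>k = 1..n. E (X k)) / p = (\<Prod>k = m + 1..n. E (X k))"
            using eventually_ge_at_top[of m]
          proof eventually_elim
            case (elim n)
            then have "{1..n} = {1..m} \<union> {m + 1..n}" by auto
            then have "(\<Prod>k = 1..n. E (X k)) = p * (\<Prod>k = m + 1..n. E (X k))"
              unfolding p_def by (simp add: prod.union_disjoint)
            then show ?case using p by simp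
          qed
          moreover have "(\<lambda>n. (\<Prod>k = 1..n. E (X k)) / p) \<longlonglongrightarrow> 0 / p"
            using none(2) p by (intro tendsto_divide tendsto_const)
          ultimately have "(\<lambda>n. \<Prod>k = m + 1..n. E (X k)) \<longlonglongrightarrow> 0"
            by (simp add: tendsto_cong)
          then show ?thesis using less_imp_le[OF m] by (intro exI[of _ m] conjI)
        qed
      qed
      then show ?weak
        unfolding weak_iff by (intro allI impI E_opow_oprod_tendsto_0) auto
    qed
  qed
qed

end
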